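(* Let $X=N+A$ be a local submartingale of class $(\Sigma)$, with only negative jumps, such that $A_\infty=\infty$ almost surely. Let $\tau_u=\inf\{t: A_t>u\}$ ($u\ge0$) be the right-continuous inverse of $A$. Let $\varphi:\mathbb{R}_+\to\mathbb{R}_+$ be a Borel function. Then $$\mathbb{P}\big(\exists t\ge 0,\; X_t>\varphi(A_t)\big)=1-\exp\left(-\int_0^\infty\frac{dx}{\varphi(x)}\right),$$ and, for every $u\ge 0$, $$\mathbb{P}\big(\exists t\le \tau_u,\; X_t>\varphi(A_t)\big)=1-\exp\left(-\int_0^u\frac{dx}{\varphi(x)}\right).$$
   Context: All processes are defined on a filtered probability space satisfying the usual conditions; "increasing" means nondecreasing. A nonnegative local submartingale $X$ with decomposition $X_t=N_t+A_t$ is of class $(\Sigma)$ if: (i) $(N_t)$ is a càdlàg local martingale with $N_0=0$; (ii) $(A_t)$ is a continuous adapted increasing process with $A_0=0$; (iii) the measure $(dA_t)$ is carried by the set $\{t: X_t=0\}$. "Only negative jumps" means $X_t-X_{t-}\le 0$ for all $t>0$ (continuous $X$ is allowed). $A_\infty=\lim_{t\to\infty}A_t$. Conventions: $1/0=\infty$ and $\exp(-\infty)=0$. *)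

theory Defs
  imports "HOL-Probability.Probability"
begin

text \<open>
  Filtrations are indexed by \<open>[0,\<infinity>]\<close>, the type \<open>ennreal\<close>, so that the library notion
  \<^const>\<open>stopping_time\<close> covers stopping times with values in \<open>[0,\<infinity>]\<close>. The \<open>\<sigma>\<close>-algebra
  \<open>F \<infinity>\<close> may be any sub-\<open>\<sigma>\<close>-algebra of \<open>M\<close> containing all \<open>F t\<close>.
  Processes have type \<open>real \<Rightarrow> 'a \<Rightarrow> real\<close>; only their values at times \<open>t \<ge> 0\<close> matter.
  Path properties are required almost surely.
\<close>

locale usual_conditions =
  prob_space M + complete_measure M + filtration "space M" F
  for M :: "'a measure" and F :: "ennreal \<Rightarrow> 'a measure" +
  assumes sets_F_subset: "\<And>t. sets (F t) \<subseteq> sets M"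
    and null_sets_F: "null_sets M \<subseteq> sets (F 0)"
    and right_continuous_F: "\<And>t. t < \<infinity> \<Longrightarrow> sets (F t) = (\<Inter>s\<in>{t<..}. sets (F s))"

definition adapted :: "(ennreal \<Rightarrow> 'a measure) \<Rightarrow> (real \<Rightarrow> 'a \<Rightarrow> real) \<Rightarrow> bool" where
  "adapted F X \<longleftrightarrow> (\<forall>t\<ge>0. X t \<in> borel_measurable (F (ennreal t)))"

definition martingale ::
  "'a measure \<Rightarrow> (ennreal \<Rightarrow> 'a measure) \<Rightarrow> (real \<Rightarrow> 'a \<Rightarrow> real) \<Rightarrow> bool" where
  "martingale M F X \<longleftrightarrow> adapted F X \<and> (\<forall>t\<ge>0. integrable M (X t)) \<and>
     (\<forall>s\<ge>0. \<forall>t\<ge>s. AE \<omega> in M. real_cond_exp M (F (ennreal s)) (X t) \<omega> = X s \<omega>)"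

definition submartingale ::
  "'a measure \<Rightarrow> (ennreal \<Rightarrow> 'a measure) \<Rightarrow> (real \<Rightarrow> 'a \<Rightarrow> real) \<Rightarrow> bool" where
  "submartingale M F X \<longleftrightarrow> adapted F X \<and> (\<forall>t\<ge>0. integrable M (X t)) \<and>
     (\<forall>s\<ge>0. \<forall>t\<ge>s. AE \<omega> in M. X s \<omega> \<le> real_cond_exp M (F (ennreal s)) (X t) \<omega>)"

definition stopped :: "(real \<Rightarrow> 'a \<Rightarrow> real) \<Rightarrow> ('a \<Rightarrow> ennreal) \<Rightarrow> real \<Rightarrow> 'a \<Rightarrow> real" where
  "stopped X T t \<omega> = X (enn2real (min (ennreal t) (T \<omega>))) \<omega>"

definition localizing_sequence ::
  "'a measure \<Rightarrow> (ennreal \<Rightarrow> 'a measure) \<Rightarrow> (nat \<Rightarrow> 'a \<Rightarrow> ennreal) \<Rightarrow> bool" where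
  "localizing_sequence M F T \<longleftrightarrow> (\<forall>n. stopping_time F (T n)) \<and>
     (AE \<omega> in M. incseq (\<lambda>n. T n \<omega>) \<and> (\<lambda>n. T n \<omega>) \<longlonglongrightarrow> \<infinity>)"

definition local_martingale ::
  "'a measure \<Rightarrow> (ennreal \<Rightarrow> 'a measure) \<Rightarrow> (real \<Rightarrow> 'a \<Rightarrow> real) \<Rightarrow> bool" where
  "local_martingale M F X \<longleftrightarrow> adapted F X \<and>
     (\<exists>T. localizing_sequence M F T \<and>
          (\<forall>n. martingale M F (\<lambda>t \<omega>. stopped X (T n) t \<omega> - X 0 \<omega>)))"

definition local_submartingale ::
  "'a measure \<Rightarrow> (ennreal \<Rightarrow> 'a measure) \<Rightarrow> (real \<Rightarrow> 'a \<Rightarrow> real) \<Rightarrow> bool" where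
  "local_submartingale M F X \<longleftrightarrow> adapted F X \<and>
     (\<exists>T. localizing_sequence M F T \<and>
          (\<forall>n. submartingale M F (\<lambda>t \<omega>. stopped X (T n) t \<omega> - X 0 \<omega>)))"

definition cadlag :: "(real \<Rightarrow> real) \<Rightarrow> bool" where
  "cadlag f \<longleftrightarrow> (\<forall>t\<ge>0. continuous (at_right t) f) \<and> (\<forall>t>0. \<exists>l. (f \<longlongrightarrow> l) (at_left t))"

text \<open>
  The measure \<open>da\<close> of a continuous increasing \<open>a\<close> on \<open>[0,\<infinity>)\<close>, viewed as a measure on the
  whole line: the function is frozen at \<open>a 0\<close> to the left of \<open>0\<close>, so no mass lies there.
\<close>
definition stieltjes :: "(real \<Rightarrow> real) \<Rightarrow> real measure" where
  "stieltjes a = interval_measure (\<lambda>t. a (max 0 t))"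

definition class_Sigma ::
  "'a measure \<Rightarrow> (ennreal \<Rightarrow> 'a measure) \<Rightarrow> (real \<Rightarrow> 'a \<Rightarrow> real) \<Rightarrow>
   (real \<Rightarrow> 'a \<Rightarrow> real) \<Rightarrow> (real \<Rightarrow> 'a \<Rightarrow> real) \<Rightarrow> bool" where
  "class_Sigma M F X N A \<longleftrightarrow>
     local_submartingale M F X \<and>
     (AE \<omega> in M. \<forall>t\<ge>0. X t \<omega> \<ge> 0) \<and>
     (AE \<omega> in M. \<forall>t\<ge>0. X t \<omega> = N t \<omega> + A t \<omega>) \<and>
     local_martingale M F N \<and>
     (AE \<omega> in M. cadlag (\<lambda>t. N t \<omega>) \<and> N 0 \<omega> = 0) \<and>
     adapted F A \<and>
     (AE \<omega> in M. continuous_on {0..} (\<lambda>t. A t \<omega>) \<and> mono_on {0..} (\<lambda>t. A t \<omega>) \<and> A 0 \<omega> = 0) \<and>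
     (AE \<omega> in M. AE t in stieltjes (\<lambda>t. A t \<omega>). t \<ge> 0 \<longrightarrow> X t \<omega> = 0)"

definition only_negative_jumps :: "'a measure \<Rightarrow> (real \<Rightarrow> 'a \<Rightarrow> real) \<Rightarrow> bool" where
  "only_negative_jumps M X \<longleftrightarrow>
     (AE \<omega> in M. \<forall>t>0. X t \<omega> - Lim (at_left t) (\<lambda>s. X s \<omega>) \<le> 0)"

text \<open>The value is \<open>\<infinity>\<close> when \<open>A\<close> never exceeds \<open>u\<close>.\<close>
definition right_inverse :: "(real \<Rightarrow> 'a \<Rightarrow> real) \<Rightarrow> real \<Rightarrow> 'a \<Rightarrow> ennreal" where
  "right_inverse A u \<omega> = Inf {ennreal t | t. t \<ge> 0 \<and> A t \<omega> > u}"

definition exp_minus :: "ennreal \<Rightarrow> real" where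
  "exp_minus a = (if a = \<infinity> then 0 else exp (- enn2real a))"

end

theory Submission
  imports Defs
begin

text \<open>
  For a bounded Borel function \<open>h \<ge> 0\<close> with primitive \<open>H\<close>, the process \<open>H(A) - h(A) X\<close> is a local martingale.
  When \<open>h\<close> is the indicator of \<open>(a,\<infinity>)\<close> it equals \<open>N\<close> stopped at \<open>\<tau>\<close>, minus \<open>N\<close>,
  where \<open>\<tau>\<close> is the inverse of \<open>A\<close> at \<open>a\<close>, because \<open>X\<close> vanishes at time \<open>\<tau>\<close>; the general case follows since half-lines
  generate the Borel sets. Let \<open>\<phi> \<ge> \<delta> > 0\<close>, let \<open>G\<close> be the primitive of \<open>1 / \<phi>\<close>, and take \<open>H = exp G - 1\<close>. Stop at the
  first time \<open>S\<close> at which \<open>X > \<phi>(A)\<close> or \<open>A > u\<close>. Since \<open>X\<close> has no positive jumps and \<open>A\<close> is constant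
  during an excursion of \<open>X\<close> from \<open>0\<close>, a passage occurs exactly at height \<open>\<phi>(A)\<close>, where
  \<open>H(A) - h(A) X = - 1\<close>; without passage, \<open>X = 0\<close> and \<open>A = u\<close>, so the value is \<open>exp (G u) - 1\<close>. The mean value
  being \<open>0\<close>, the probability of a passage is \<open>1 - exp (- G u)\<close>. Monotone limits remove \<open>\<delta>\<close> and \<open>u\<close>.
\<close>

text \<open>The choice of \<open>H\<close> solves an equation: for \<open>H(A) - h(A) X\<close> to
  take the same value at every passage, where \<open>X = \<phi>(A)\<close>, the function
  \<open>H - \<phi> H'\<close> must be constant, and the constant -1 together with
  \<open>H(0) = 0\<close> forces \<open>H = exp G - 1\<close>. As \<phi> is merely Borel,
  \<open>h\<close> may be discontinuous everywhere, and Ito's formula does not apply to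
  \<open>h(A) X\<close>. The local martingale property is therefore used in expectation only: at
  suitable bounded times the means of \<open>h(A) X\<close> and \<open>H(A)\<close> agree. Both are
  nonnegative and depend on \<open>h\<close> like a measure, so no continuity of \<open>h\<close>
  enters. The localizing times have to be removed before the value at \<open>S\<close> can be read
  off, although \<open>X\<close> may be unbounded before \<open>S\<close>. Domination comes from the
  barrier itself: up to time \<open>S\<close> one has \<open>X \<le> \<phi>(A)\<close>, so
  \<open>h(A) X\<close> is at most \<open>exp (G u)\<close>.\<close>

section \<open>Limits of integrals, and calculus for exponentials of primitives\<close>

text \<open>Vitali's convergence theorem, with uniform integrability given by a tail bound \<delta>.
  Splitting at one level \<open>l0\<close> bounds the first moments, so Fatou makes \<open>W\<close>
  integrable. Truncation at level \<open>l\<close> changes each mean by at most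
  \<open>\<delta> l\<close>, the truncated means converge by domination, and finally
  \<open>l\<close> tends to infinity.\<close>

lemma (in prob_space) uniformly_integrable_integral_limit:
  fixes V :: "nat \<Rightarrow> 'a \<Rightarrow> real"
  assumes V: "\<And>k. integrable M (V k)" and [measurable]: "W \<in> borel_measurable M"
    and lim: "AE \<omega> in M. (\<lambda>k. V k \<omega>) \<longlonglongrightarrow> W \<omega>"
    and c: "\<And>k. (\<integral>\<omega>. V k \<omega> \<partial>M) = c"
    and tail: "\<And>k l. l > 0 \<Longrightarrow> (\<integral>\<omega>. \<bar>V k \<omega>\<bar> * indicator {l<..} \<bar>V k \<omega>\<bar> \<partial>M) \<le> \<delta> l"
    and \<delta>: "(\<delta> \<longlongrightarrow> 0) at_top"
  shows "integrable M W" "(\<integral>\<omega>. W \<omega> \<partial>M) = c"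
proof -
  have [measurable]: "V k \<in> borel_measurable M" for k
    using V by auto
  have tail_int: "integrable M (\<lambda>\<omega>. \<bar>V k \<omega>\<bar> * indicator {l<..} \<bar>V k \<omega>\<bar>)" for k l
    by (rule Bochner_Integration.integrable_bound[OF V[of k]]) (auto simp: indicator_def)
  obtain l0 :: real where l0: "l0 > 0" "\<delta> l0 \<le> 1"
  proof -
    have "eventually (\<lambda>l. \<delta> l < 1 \<and> l > 0) at_top"
      using order_tendstoD(2)[OF \<delta>, of 1] eventually_gt_at_top[of 0]
      by (auto intro: eventually_conj)
    then have "\<exists>l. \<delta> l < 1 \<and> l > 0"
      by (rule eventually_happens'[OF trivial_limit_at_top_linorder])
    then show ?thesis using that by force
  qed
  have bnd: "(\<integral>\<^sup>+\<omega>. ennreal \<bar>V k \<omega>\<bar> \<partial>M) \<le> ennreal (l0 + 1)" for k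
  proof -
    have "(\<integral>\<omega>. \<bar>V k \<omega>\<bar> \<partial>M) \<le> (\<integral>\<omega>. l0 + \<bar>V k \<omega>\<bar> * indicator {l0<..} \<bar>V k \<omega>\<bar> \<partial>M)"
      using l0 V tail_int by (intro integral_mono) (auto simp: indicator_def)
    also have "\<dots> \<le> l0 + 1"
      using tail[of l0 k] l0 tail_int by (simp add: prob_space)
    finally show ?thesis
      using V by (simp add: nn_integral_eq_integral ennreal_leI)
  qed
  have "(\<integral>\<^sup>+\<omega>. ennreal \<bar>W \<omega>\<bar> \<partial>M) = (\<integral>\<^sup>+\<omega>. liminf (\<lambda>k. ennreal \<bar>V k \<omega>\<bar>) \<partial>M)"
  proof (rule nn_integral_cong_AE)
    show "AE \<omega> in M. ennreal \<bar>W \<omega>\<bar> = liminf (\<lambda>k. ennreal \<bar>V k \<omega>\<bar>)"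
      using lim
    proof eventually_elim
      case (elim \<omega>)
      then have "(\<lambda>k. ennreal \<bar>V k \<omega>\<bar>) \<longlonglongrightarrow> ennreal \<bar>W \<omega>\<bar>"
        by (intro tendsto_intros)
      then show ?case
        by (metis lim_imp_Liminf sequentially_bot)
    qed
  qed
  also have "\<dots> \<le> liminf (\<lambda>k. \<integral>\<^sup>+\<omega>. ennreal \<bar>V k \<omega>\<bar> \<partial>M)"
    by (rule nn_integral_liminf) simp
  also have "\<dots> \<le> ennreal (l0 + 1)"
    using bnd by (intro Liminf_le) auto
  finally show W: "integrable M W"
    by (intro integrableI_bounded) (auto simp: order_le_less_trans)
  define \<psi> :: "real \<Rightarrow> real \<Rightarrow> real" where "\<psi> l x = max (- l) (min l x)" for l x
  have [measurable]: "\<psi> l \<in> borel_measurable borel" for l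
    unfolding \<psi>_def by measurable
  have trunc: "\<bar>c - (\<integral>\<omega>. \<psi> l (W \<omega>) \<partial>M)\<bar> \<le> \<delta> l" if "l > 0" for l
  proof -
    have "\<bar>c - (\<integral>\<omega>. \<psi> l (V k \<omega>) \<partial>M)\<bar> \<le> \<delta> l" for k
    proof -
      have int: "integrable M (\<lambda>\<omega>. \<psi> l (V k \<omega>))"
        by (rule Bochner_Integration.integrable_bound[OF V[of k]]) (use that in \<open>auto simp: \<psi>_def\<close>)
      have "\<bar>c - (\<integral>\<omega>. \<psi> l (V k \<omega>) \<partial>M)\<bar> = \<bar>\<integral>\<omega>. V k \<omega> - \<psi> l (V k \<omega>) \<partial>M\<bar>"
        using V int c by simp
      also have "\<dots> \<le> (\<integral>\<omega>. \<bar>V k \<omega> - \<psi> l (V k \<omega>)\<bar> \<partial>M)"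
        by (rule integral_abs_bound)
      also have "\<dots> \<le> (\<integral>\<omega>. \<bar>V k \<omega>\<bar> * indicator {l<..} \<bar>V k \<omega>\<bar> \<partial>M)"
      proof (rule integral_mono)
        show "integrable M (\<lambda>\<omega>. \<bar>V k \<omega> - \<psi> l (V k \<omega>)\<bar>)"
          using V int by auto
        show "\<bar>V k \<omega> - \<psi> l (V k \<omega>)\<bar> \<le> \<bar>V k \<omega>\<bar> * indicator {l<..} \<bar>V k \<omega>\<bar>" for \<omega>
          using that by (auto simp: \<psi>_def indicator_def)
      qed (rule tail_int)
      finally show ?thesis using tail[OF that, of k] by simp
    qed
    moreover have "(\<lambda>k. \<integral>\<omega>. \<psi> l (V k \<omega>) \<partial>M) \<longlonglongrightarrow> (\<integral>\<omega>. \<psi> l (W \<omega>) \<partial>M)"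
    proof (rule integral_dominated_convergence[where w = "\<lambda>_. l"])
      show "AE \<omega> in M. (\<lambda>k. \<psi> l (V k \<omega>)) \<longlonglongrightarrow> \<psi> l (W \<omega>)"
        using lim by eventually_elim (auto simp: \<psi>_def intro!: tendsto_intros)
      show "AE \<omega> in M. norm (\<psi> l (V k \<omega>)) \<le> l" for k
        using that by (auto simp: \<psi>_def)
    qed auto
    ultimately show ?thesis
      by (intro LIMSEQ_le_const2[where X = "\<lambda>k. \<bar>c - (\<integral>\<omega>. \<psi> l (V k \<omega>) \<partial>M)\<bar>"] tendsto_intros) auto
  qed
  have "((\<lambda>l. \<integral>\<omega>. \<psi> l (W \<omega>) \<partial>M) \<longlongrightarrow> (\<integral>\<omega>. W \<omega> \<partial>M)) at_top"
  proof (rule integral_dominated_convergence_at_top[where w = "\<lambda>\<omega>. \<bar>W \<omega>\<bar>"])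
    show "AE \<omega> in M. ((\<lambda>l. \<psi> l (W \<omega>)) \<longlongrightarrow> W \<omega>) at_top"
    proof (rule AE_I2)
      fix \<omega>
      show "((\<lambda>l. \<psi> l (W \<omega>)) \<longlongrightarrow> W \<omega>) at_top"
        by (rule tendsto_eventually)
          (use eventually_ge_at_top[of "\<bar>W \<omega>\<bar>"] in \<open>eventually_elim, auto simp: \<psi>_def\<close>)
    qed
    show "\<forall>\<^sub>F l in at_top. AE \<omega> in M. norm (\<psi> l (W \<omega>)) \<le> \<bar>W \<omega>\<bar>"
      using eventually_ge_at_top[of 0] by eventually_elim (auto simp: \<psi>_def)
  qed (use W in auto)
  then have "((\<lambda>l. \<bar>c - (\<integral>\<omega>. \<psi> l (W \<omega>) \<partial>M)\<bar>) \<longlongrightarrow> \<bar>c - (\<integral>\<omega>. W \<omega> \<partial>M)\<bar>) at_top"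
    by (intro tendsto_intros)
  moreover have "((\<lambda>l. \<bar>c - (\<integral>\<omega>. \<psi> l (W \<omega>) \<partial>M)\<bar>) \<longlongrightarrow> 0) at_top"
    by (rule tendsto_sandwich[OF _ _ tendsto_const \<delta>])
      (auto intro!: eventually_mono[OF eventually_gt_at_top[of 0]] trunc)
  ultimately have "\<bar>c - (\<integral>\<omega>. W \<omega> \<partial>M)\<bar> = 0"
    by (rule tendsto_unique[OF trivial_limit_at_top_linorder])
  then show "(\<integral>\<omega>. W \<omega> \<partial>M) = c" by simp
qed

lemma tendsto_exp_minus:
  assumes a: "(a \<longlongrightarrow> l) G"
  shows "((\<lambda>n. exp_minus (a n)) \<longlongrightarrow> exp_minus l) G"
proof (cases "l = \<infinity>")
  case False
  then have "eventually (\<lambda>n. a n < \<infinity>) G"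
    using a by (intro order_tendstoD(2)) (auto simp: less_top)
  then have "eventually (\<lambda>n. exp_minus (a n) = exp (- enn2real (a n))) G"
    by eventually_elim (auto simp: exp_minus_def)
  moreover have "(a \<longlongrightarrow> ennreal (enn2real l)) G"
    using False a by (simp add: ennreal_enn2real_if)
  then have "((\<lambda>n. exp (- enn2real (a n))) \<longlongrightarrow> exp (- enn2real l)) G"
    by (intro tendsto_intros) auto
  ultimately show ?thesis
    using False by (simp add: exp_minus_def tendsto_cong)
next
  case True
  have "eventually (\<lambda>n. exp_minus (a n) < e) G" if "0 < e" for e
  proof -
    \<comment> \<open>Beyond \<open>- ln e\<close> the exponential is below \<open>e\<close>; the
      \<open>max\<close> keeps the threshold nonnegative, so that \<open>ennreal\<close> does not
      alter it.\<close>
    have "eventually (\<lambda>n. ennreal (max 0 (- ln e)) < a n) G"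
      using a True by (intro order_tendstoD(1)) auto
    then show ?thesis
    proof eventually_elim
      case (elim n)
      show ?case
      proof (cases "a n")
        case (real r)
        have "max 0 (- ln e) < r"
          using elim unfolding real(2) by (subst (asm) ennreal_less_iff) auto
        then have "- ln e < r" by simp
        then have "exp (- r) < exp (ln e)"
          by simp
        then show ?thesis
          using \<open>0 < e\<close> real by (simp add: exp_minus_def)
      qed (simp add: exp_minus_def \<open>0 < e\<close>)
    qed
  qed
  moreover have "eventually (\<lambda>n. y < exp_minus (a n)) G" if "y < 0" for y
    using that by (intro always_eventually allI) (simp add: exp_minus_def less_trans[OF _ exp_gt_zero])
  ultimately have "((\<lambda>n. exp_minus (a n)) \<longlongrightarrow> 0) G"
    by (intro order_tendstoI)
  then show ?thesis using True by (simp add: exp_minus_def)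
qed

text \<open>A quadratic bound on increments makes the derivative vanish at every point. This proves
  an integral formula by estimates on short intervals, without differentiating the integrals
  involved.\<close>

lemma constant_if_quadratic_increments:
  fixes J :: "real \<Rightarrow> real"
  assumes "\<And>x y. a \<le> x \<Longrightarrow> x \<le> y \<Longrightarrow> y \<le> b \<Longrightarrow> \<bar>J y - J x\<bar> \<le> K * (y - x)\<^sup>2" "a \<le> b"
  shows "J b = J a"
proof -
  have K: "\<bar>J y - J x\<bar> \<le> K * (y - x)\<^sup>2" if "x \<in> {a..b}" "y \<in> {a..b}" for x y
    using assms(1)[of x y] assms(1)[of y x] that
    by (cases "x \<le> y") (auto simp: abs_minus_commute power2_commute)
  have "(J has_field_derivative 0) (at x within {a..b})" if x: "x \<in> {a..b}" for x
    unfolding has_field_derivative_iff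
  proof (rule Lim_null_comparison)
    show "\<forall>\<^sub>F y in at x within {a..b}. norm ((J y - J x) / (y - x)) \<le> K * \<bar>y - x\<bar>"
      unfolding eventually_at_filter
    proof (intro always_eventually allI impI)
      fix y assume y: "y \<noteq> x" "y \<in> {a..b}"
      have "\<bar>J y - J x\<bar> \<le> (K * \<bar>y - x\<bar>) * \<bar>y - x\<bar>"
        using K[OF x y(2)] by (simp add: power2_eq_square)
      then show "norm ((J y - J x) / (y - x)) \<le> K * \<bar>y - x\<bar>"
        using y by (simp add: divide_le_eq abs_divide)
    qed
    show "((\<lambda>y. K * \<bar>y - x\<bar>) \<longlongrightarrow> 0) (at x within {a..b})"
      by (auto intro!: tendsto_eq_intros)
  qed
  then obtain c where "\<And>x. x \<in> {a..b} \<Longrightarrow> J x = c"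
    using has_field_derivative_zero_constant[of "{a..b}" J] by auto
  then show ?thesis using \<open>a \<le> b\<close> by simp
qed

lemma borel_bounded_integrable_on_Icc:
  fixes g :: "real \<Rightarrow> real"
  assumes [measurable]: "g \<in> borel_measurable borel" and B: "\<And>z. z \<in> {x..y} \<Longrightarrow> \<bar>g z\<bar> \<le> B"
  shows "g integrable_on {x..y}"
proof (rule set_borel_integral_eq_integral(1))
  have "integrable lborel (indicator {x..y} :: real \<Rightarrow> real)"
    by (rule integrable_real_indicator) (auto simp: emeasure_lborel_Icc_eq)
  then have "integrable lborel (\<lambda>z. indicator {x..y} z * B)"
    by (rule integrable_mult_left)
  then show "set_integrable lborel {x..y} g"
    unfolding set_integrable_def
    by (rule Bochner_Integration.integrable_bound)
      (use B in \<open>auto simp: indicator_def intro!: AE_I2 order_trans[OF _ abs_ge_self]\<close>)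
qed

lemma mono_primitive:
  fixes f :: "real \<Rightarrow> real"
  assumes "f \<in> borel_measurable borel" and f: "\<And>x. 0 \<le> f x" "\<And>x. f x \<le> C"
  shows "mono (\<lambda>x. integral {0..x} f)"
  using assms
  by (intro monoI integral_subset_le borel_bounded_integrable_on_Icc[of f _ _ C]) auto

text \<open>The primitive \<open>G\<close> of a bounded Borel function need not be differentiable at
  every point, so the chain rule for \<open>exp G\<close> is replaced by an estimate: the increments
  of the integral of \<open>f exp G\<close> and of \<open>exp G\<close> differ only quadratically in
  the length of the interval.\<close>

lemma nn_integral_exp_primitive:
  fixes f :: "real \<Rightarrow> real"
  assumes [measurable]: "f \<in> borel_measurable borel" and f: "\<And>x. 0 \<le> f x" "\<And>x. f x \<le> C"
  defines "G \<equiv> \<lambda>x. integral {0..x} f"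
  assumes "0 \<le> a"
  shows "(\<integral>\<^sup>+x\<in>{0..a}. ennreal (f x * exp (G x)) \<partial>lborel) = ennreal (exp (G a) - 1)"
proof -
  have C: "0 \<le> C" using f[of 0] by simp
  have f_ion: "f integrable_on {x..y}" for x y
    by (rule borel_bounded_integrable_on_Icc[where B = C]) (use f in auto)
  have G_diff: "G y - G x = integral {x..y} f" if "0 \<le> x" "x \<le> y" for x y
    using Henstock_Kurzweil_Integration.integral_combine[of 0 x y f] that f_ion by (simp add: G_def)
  have "mono G"
    unfolding G_def by (rule mono_primitive) (use f in auto)
  then have G_mono: "G x \<le> G y" if "x \<le> y" for x y
    using that by (rule monoD)
  have [measurable]: "G \<in> borel_measurable borel"
    using \<open>mono G\<close> by (rule borel_measurable_mono)
  have G_le: "G y - G x \<le> C * (y - x)" if "0 \<le> x" "x \<le> y" for x y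
    unfolding G_diff[OF that]
    using Henstock_Kurzweil_Integration.integral_le[OF f_ion integrable_const_ivl, of x y C] f that
    by (simp add: mult.commute)
  define h where "h x = f x * exp (G x)" for x
  have [measurable]: "h \<in> borel_measurable borel"
    unfolding h_def by measurable
  have h_ion: "h integrable_on {x..y}" for x y
    by (rule borel_bounded_integrable_on_Icc[where B = "C * exp (G y)"]) (use f G_mono C in \<open>auto simp: h_def abs_mult intro!: mult_mono\<close>)
  define J where "J x = integral {0..x} h - exp (G x)" for x
  have "J a = J 0"
  proof (rule constant_if_quadratic_increments[where J = J and K = "C * (exp (G a) * C)"])
    fix x y assume xy: "0 \<le> x" "x \<le> y" "y \<le> a"
    \<comment> \<open>The increment of \<open>exp G\<close> is then the integral of
      \<open>m f\<close>, with \<open>m\<close> in the range of \<open>exp G\<close> over the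
      interval. Against \<open>h = f exp G\<close> the error is at most \<open>C\<close> times the
      oscillation of \<open>exp G\<close>, itself at most \<open>exp (G a) * C * (y - x)\<close>;
      integration supplies the second factor \<open>y - x\<close>.\<close>
    have "\<exists>m. exp (G x) \<le> m \<and> m \<le> exp (G y) \<and> exp (G y) - exp (G x) = m * (G y - G x)"
    proof (cases "G x < G y")
      case True
      then obtain z where "G x < z" "z < G y" "exp (G y) - exp (G x) = (G y - G x) * exp z"
        using MVT2[of "G x" "G y" exp exp] by (auto intro: DERIV_exp)
      then show ?thesis by (intro exI[of _ "exp z"]) auto
    next
      case False
      then have "G x = G y" using G_mono[OF xy(2)] by simp
      then show ?thesis by (intro exI[of _ "exp (G x)"]) simp
    qed
    then obtain m where m: "exp (G x) \<le> m" "m \<le> exp (G y)" "exp (G y) - exp (G x) = m * (G y - G x)"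
      by blast
    have d: "exp (G y) - exp (G x) \<le> exp (G a) * (C * (y - x))"
    proof -
      have "m * (G y - G x) \<le> exp (G a) * (C * (y - x))"
        using m G_le[of x y] G_mono[of x y] G_mono[of y a] xy
        by (intro mult_mono) (auto intro: order_trans[OF m(2)] )
      then show ?thesis using m by simp
    qed
    have "J y - J x = integral {x..y} h - m * integral {x..y} f"
      using Henstock_Kurzweil_Integration.integral_combine[of 0 x y h] xy h_ion m G_diff[of x y]
      by (simp add: J_def algebra_simps)
    also have "\<dots> = integral {x..y} (\<lambda>z. h z - m * f z)"
      using h_ion f_ion
      by (subst Henstock_Kurzweil_Integration.integral_diff)
        (auto intro: integrable_on_mult_right)
    finally have eq: "J y - J x = integral {x..y} (\<lambda>z. h z - m * f z)" .
    have "norm (integral {x..y} (\<lambda>z. h z - m * f z)) \<le> integral {x..y} (\<lambda>_. C * (exp (G a) * (C * (y - x))))"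
    proof (rule integral_norm_bound_integral)
      show "(\<lambda>z. h z - m * f z) integrable_on {x..y}"
        using h_ion f_ion by (intro Henstock_Kurzweil_Integration.integrable_diff integrable_on_mult_right)
      fix z assume z: "z \<in> {x..y}"
      have "\<bar>exp (G z) - m\<bar> \<le> exp (G y) - exp (G x)"
        using m G_mono[of x z] G_mono[of z y] z by (simp add: abs_le_iff) (smt (verit) exp_le_cancel_iff)
      then have "\<bar>f z\<bar> * \<bar>exp (G z) - m\<bar> \<le> C * (exp (G a) * (C * (y - x)))"
        using f d C by (intro mult_mono) auto
      then show "norm (h z - m * f z) \<le> C * (exp (G a) * (C * (y - x)))"
        by (simp add: h_def abs_mult[symmetric] algebra_simps)
    qed auto
    then show "\<bar>J y - J x\<bar> \<le> C * (exp (G a) * C) * (y - x)\<^sup>2"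
      using xy by (simp add: eq power2_eq_square algebra_simps)
  qed fact
  moreover have "G 0 = 0" by (simp add: G_def)
  ultimately have "(h has_integral (exp (G a) - 1)) {0..a}"
    using h_ion[of 0 a] by (simp add: J_def has_integral_iff)
  then have "(\<integral>\<^sup>+x. ennreal (indicator {0..a} x * h x) \<partial>lborel) = ennreal (exp (G a) - 1)"
    by (rule nn_integral_has_integral_lebesgue[rotated]) (simp add: h_def f)
  then show ?thesis
    by (simp add: h_def ennreal_mult' ennreal_indicator f mult.commute)
qed

section \<open>Optional stopping for right-continuous martingales\<close>

text \<open>For \<open>s \<ge> 0\<close> this is the least multiple of \<open>1/(k+1)\<close>
  strictly above \<open>s\<close>. Strictness makes the event that a random time falls into a given
  cell a difference of two events of the form \<open>S < t\<close>.\<close>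

definition grid :: "nat \<Rightarrow> real \<Rightarrow> real" where
  "grid k s = real (Suc (nat \<lfloor>real (Suc k) * s\<rfloor>)) / real (Suc k)"

lemma grid_bounds:
  assumes "0 \<le> s"
  shows "s < grid k s" "grid k s \<le> s + 1 / real (Suc k)"
proof -
  have n: "real (nat \<lfloor>real (Suc k) * s\<rfloor>) = of_int \<lfloor>real (Suc k) * s\<rfloor>"
    using assms by simp
  have "real (Suc k) * s < real (Suc (nat \<lfloor>real (Suc k) * s\<rfloor>))"
    unfolding of_nat_Suc[of "nat \<lfloor>real (Suc k) * s\<rfloor>"] n by linarith
  then show "s < grid k s"
    unfolding grid_def by (subst less_divide_eq) (simp add: mult.commute del: of_nat_Suc)
  have "real (Suc (nat \<lfloor>real (Suc k) * s\<rfloor>)) \<le> real (Suc k) * s + 1"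
    unfolding of_nat_Suc[of "nat \<lfloor>real (Suc k) * s\<rfloor>"] n by linarith
  then have "grid k s \<le> (real (Suc k) * s + 1) / real (Suc k)"
    unfolding grid_def by (intro divide_right_mono) auto
  also have "\<dots> = s + 1 / real (Suc k)"
    by (simp add: field_simps del: of_nat_Suc)
  finally show "grid k s \<le> s + 1 / real (Suc k)" .
qed

lemma filterlim_grid:
  assumes "0 \<le> s"
  shows "filterlim (\<lambda>k. grid k s) (at_right s) sequentially"
  unfolding filterlim_at
proof safe
  show "\<forall>\<^sub>F k in sequentially. grid k s \<in> {s<..} \<and> grid k s \<noteq> s"
    using grid_bounds(1)[OF assms] by (auto simp: less_imp_neq[symmetric])
  have "(\<lambda>k. s + 1 / real (Suc k)) \<longlonglongrightarrow> s + 0"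
    by (intro tendsto_intros LIMSEQ_Suc[OF lim_1_over_n])
  then have "(\<lambda>k. s + 1 / real (Suc k)) \<longlonglongrightarrow> s" by simp
  then show "(\<lambda>k. grid k s) \<longlonglongrightarrow> s"
    by (rule tendsto_sandwich[OF always_eventually always_eventually tendsto_const, rotated 2])
      (simp_all add: grid_bounds[OF assms] less_imp_le[OF grid_bounds(1)[OF assms]] del: of_nat_Suc)
qed

text \<open>The \<open>max\<close> guards against the unspecified value of \<open>Inf {}\<close>.\<close>
definition debut :: "(real \<Rightarrow> 'a \<Rightarrow> bool) \<Rightarrow> 'a \<Rightarrow> real" where
  "debut P \<omega> = max 0 (Inf {t. 0 \<le> t \<and> P t \<omega>})"

section \<open>Measurability and random times under the usual conditions\<close>

context usual_conditions
begin

text \<open>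
  Only \<open>{S < t}\<close> is required to be \<open>F t\<close>-measurable: the grid times approximate \<open>S\<close> strictly from
  the right, so optional stopping needs no more.
\<close>
definition optional_time :: "('a \<Rightarrow> real) \<Rightarrow> bool" where
  "optional_time S \<longleftrightarrow> (\<forall>\<omega>. 0 \<le> S \<omega>) \<and> (\<forall>t. {\<omega> \<in> space M. S \<omega> < t} \<in> sets (F (ennreal t)))"

lemma measurable_F_M: "f \<in> measurable (F t) N \<Longrightarrow> f \<in> measurable M N"
  using sets_F_subset[of t] space_F[of t] by (auto simp: measurable_def subset_iff)

lemma borel_measurable_AE_eq:
  fixes f g :: "'a \<Rightarrow> real"
  assumes [measurable]: "f \<in> borel_measurable M" and "AE \<omega> in M. f \<omega> = g \<omega>"
  shows "g \<in> borel_measurable M"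
proof (rule borel_measurableI_less)
  fix y
  show "{\<omega> \<in> space M. g \<omega> < y} \<in> sets M"
    by (rule in_sets_AE[of "{\<omega> \<in> space M. f \<omega> < y}"]) (use assms(2) in auto)
qed

lemma measurable_prob_AE_eq:
  assumes "C \<in> sets M" "AE \<omega> in M. \<omega> \<in> C \<longleftrightarrow> P \<omega>"
  shows "{\<omega> \<in> space M. P \<omega>} \<in> sets M \<and> prob {\<omega> \<in> space M. P \<omega>} = prob C"
proof
  have AE: "AE \<omega> in M. \<omega> \<in> C \<longleftrightarrow> \<omega> \<in> {\<omega> \<in> space M. P \<omega>}"
    using assms(2) AE_space by eventually_elim auto
  then show D: "{\<omega> \<in> space M. P \<omega>} \<in> sets M"
    by (rule in_sets_AE) (use assms(1) in auto)
  show "prob {\<omega> \<in> space M. P \<omega>} = prob C"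
    by (rule measure_eq_AE[OF _ D assms(1)]) (use AE in \<open>auto elim: eventually_mono\<close>)
qed

text \<open>Path properties hold only almost surely, so events described through paths must be
  corrected on a null set. By completeness every subset of a null set is itself a null set, hence
  lies in \<open>F 0\<close> and in every \<open>F t\<close>.\<close>

lemma sets_F_AE_eq:
  assumes B: "B \<in> sets (F t)" and eq: "AE \<omega> in M. \<omega> \<in> B \<longleftrightarrow> P \<omega>"
  shows "{\<omega> \<in> space M. P \<omega>} \<in> sets (F t)"
proof -
  define D where "D = {\<omega> \<in> space M. \<not> (\<omega> \<in> B \<longleftrightarrow> P \<omega>)}"
  have "D \<in> null_sets M"
    using eq unfolding D_def AE_iff_null_sets .
  then have D: "E \<in> sets (F t)" if "E \<subseteq> D" for E
    using complete2[OF that] null_sets_F sets_F_mono[of 0 t] by auto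
  have "{\<omega> \<in> space M. P \<omega>} = (B - B \<inter> D) \<union> {\<omega> \<in> space M. P \<omega>} \<inter> D"
    using sets.sets_into_space[OF B] by (auto simp: D_def space_F)
  also have "\<dots> \<in> sets (F t)"
    by (intro sets.Un sets.Diff[OF B] D) auto
  finally show ?thesis .
qed

lemma optional_time_nonneg: "optional_time S \<Longrightarrow> 0 \<le> S \<omega>"
  unfolding optional_time_def by blast

lemma optional_time_less: "optional_time S \<Longrightarrow> {\<omega> \<in> space M. S \<omega> < t} \<in> sets (F (ennreal t))"
  unfolding optional_time_def by blast

lemma optional_time_measurable: "optional_time S \<Longrightarrow> S \<in> borel_measurable M"
  by (intro borel_measurableI_less subsetD[OF sets_F_subset optional_time_less])

lemma optional_time_min:
  assumes "optional_time S" "optional_time T"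
  shows "optional_time (\<lambda>\<omega>. min (S \<omega>) (T \<omega>))"
proof -
  have "{\<omega> \<in> space M. min (S \<omega>) (T \<omega>) < t} = {\<omega> \<in> space M. S \<omega> < t} \<union> {\<omega> \<in> space M. T \<omega> < t}" for t
    by auto
  moreover have "{\<omega> \<in> space M. S \<omega> < t} \<union> {\<omega> \<in> space M. T \<omega> < t} \<in> sets (F (ennreal t))" for t
    using assms by (intro sets.Un optional_time_less)
  ultimately show ?thesis
    using optional_time_nonneg[OF assms(1)] optional_time_nonneg[OF assms(2)]
    by (simp add: optional_time_def)
qed

lemma optional_time_const:
  assumes "0 \<le> c"
  shows "optional_time (\<lambda>_. c)"
  unfolding optional_time_def
proof safe
  fix t
  have "{\<omega> \<in> space M. c < t} = (if c < t then space (F (ennreal t)) else {})"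
    by (simp add: space_F)
  then show "{\<omega> \<in> space M. c < t} \<in> sets (F (ennreal t))"
    by (simp only:) simp
qed (rule assms)

text \<open>If \<open>P\<close> holds at some time before \<open>t\<close>, it still holds shortly
  afterwards, hence at a rational time before \<open>t\<close>. The uncountable search thus becomes
  a countable union of events known at time \<open>t\<close>.\<close>

lemma optional_time_debut:
  assumes P: "\<And>t. 0 \<le> t \<Longrightarrow> {\<omega> \<in> space M. P t \<omega>} \<in> sets (F (ennreal t))"
    and AE: "AE \<omega> in M. (\<exists>t\<ge>0. P t \<omega>) \<and> (\<forall>t\<ge>0. P t \<omega> \<longrightarrow> eventually (\<lambda>s. P s \<omega>) (at_right t))"
  shows "optional_time (debut P)"
  unfolding optional_time_def
proof safe
  show "0 \<le> debut P \<omega>" for \<omega>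
    by (simp add: debut_def)
next
  fix t :: real
  let ?B = "\<Union>q\<in>{q\<in>\<rat>. 0 \<le> q \<and> q < t}. {\<omega> \<in> space M. P q \<omega>}"
  show "{\<omega> \<in> space M. debut P \<omega> < t} \<in> sets (F (ennreal t))"
  proof (rule sets_F_AE_eq)
    show "?B \<in> sets (F (ennreal t))"
    proof (rule sets.countable_UN'')
      show "countable {q\<in>\<rat>. 0 \<le> q \<and> q < t}"
        by (rule countable_subset[OF _ countable_rat]) auto
      fix q assume "q \<in> {q\<in>\<rat>. 0 \<le> q \<and> q < t}"
      then show "{\<omega> \<in> space M. P q \<omega>} \<in> sets (F (ennreal t))"
        using P[of q] sets_F_mono[of "ennreal q" "ennreal t"] by (auto intro: ennreal_leI)
    qed
    show "AE \<omega> in M. \<omega> \<in> ?B \<longleftrightarrow> debut P \<omega> < t"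
      using AE AE_space
    proof eventually_elim
      case (elim \<omega>)
      let ?A = "{t. 0 \<le> t \<and> P t \<omega>}"
      have A: "?A \<noteq> {}" "bdd_below ?A"
        using elim by (auto intro: bdd_belowI[of _ 0])
      have debut: "debut P \<omega> = Inf ?A"
        using cInf_greatest[OF A(1), of 0] by (auto simp: debut_def)
      show ?case
      proof
        assume "\<omega> \<in> ?B"
        then show "debut P \<omega> < t"
          unfolding debut using cInf_lower[OF _ A(2)] by (auto intro: order_le_less_trans)
      next
        assume "debut P \<omega> < t"
        then obtain s where s: "0 \<le> s" "P s \<omega>" "s < t"
          unfolding debut cInf_less_iff[OF A] by auto
        then have "eventually (\<lambda>s. P s \<omega>) (at_right s)"
          using elim by auto
        then obtain b where b: "s < b" "\<And>y. s < y \<Longrightarrow> y < b \<Longrightarrow> P y \<omega>"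
          unfolding eventually_at_right_field by auto
        then obtain q where "q \<in> \<rat>" "s < q" "q < min b t"
          using Rats_dense_in_real[of s "min b t"] s by auto
        then show "\<omega> \<in> ?B"
          using b s elim by auto
      qed
    qed
  qed
qed

text \<open>The grid times take countably many values, so evaluation there is measurable for a
  family of random variables. Right-continuity carries this over to \<open>S\<close>, up to a null
  set that completeness absorbs.\<close>

lemma borel_measurable_eval:
  fixes Y :: "real \<Rightarrow> 'a \<Rightarrow> real"
  assumes Y: "\<And>t. 0 \<le> t \<Longrightarrow> Y t \<in> borel_measurable M"
    and rc: "AE \<omega> in M. \<forall>t\<ge>0. continuous (at_right t) (\<lambda>s. Y s \<omega>)"
    and [measurable]: "S \<in> borel_measurable M" and S: "\<And>\<omega>. 0 \<le> S \<omega>"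
  shows "(\<lambda>\<omega>. Y (S \<omega>) \<omega>) \<in> borel_measurable M"
    and "AE \<omega> in M. (\<lambda>k. Y (grid k (S \<omega>)) \<omega>) \<longlonglongrightarrow> Y (S \<omega>) \<omega>"
    and "\<And>k. (\<lambda>\<omega>. Y (grid k (S \<omega>)) \<omega>) \<in> borel_measurable M"
proof -
  show [measurable]: "(\<lambda>\<omega>. Y (grid k (S \<omega>)) \<omega>) \<in> borel_measurable M" for k
    unfolding grid_def
  proof (rule measurable_compose_countable[where f = "\<lambda>n \<omega>. Y (real (Suc n) / real (Suc k)) \<omega>"])
    show "(\<lambda>\<omega>. Y (real (Suc n) / real (Suc k)) \<omega>) \<in> borel_measurable M" for n
      by (rule Y) simp
  qed measurable
  show lim: "AE \<omega> in M. (\<lambda>k. Y (grid k (S \<omega>)) \<omega>) \<longlonglongrightarrow> Y (S \<omega>) \<omega>"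
    using rc
  proof eventually_elim
    case (elim \<omega>)
    then have "((\<lambda>s. Y s \<omega>) \<longlongrightarrow> Y (S \<omega>) \<omega>) (at_right (S \<omega>))"
      using S by (simp add: continuous_within)
    then show ?case
      by (rule filterlim_compose[OF _ filterlim_grid[OF S]])
  qed
  show "(\<lambda>\<omega>. Y (S \<omega>) \<omega>) \<in> borel_measurable M"
  proof (rule borel_measurable_AE_eq)
    show "(\<lambda>\<omega>. lim (\<lambda>k. Y (grid k (S \<omega>)) \<omega>)) \<in> borel_measurable M"
      by measurable
    show "AE \<omega> in M. lim (\<lambda>k. Y (grid k (S \<omega>)) \<omega>) = Y (S \<omega>) \<omega>"
      using lim by eventually_elim (rule limI)
  qed
qed

lemma martingale_set_integral:
  assumes Y: "martingale M F Y" and "0 \<le> s" "s \<le> t" and B: "B \<in> sets (F (ennreal s))"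
  shows "(\<integral>\<omega>. indicator B \<omega> * Y s \<omega> \<partial>M) = (\<integral>\<omega>. indicator B \<omega> * Y t \<omega> \<partial>M)"
proof -
  interpret finite_measure_subalgebra M "F (ennreal s)"
    by unfold_locales (simp add: subalgebra_def space_F sets_F_subset)
  have [measurable]: "B \<in> sets M"
    using sets_F_subset B by (rule subsetD)
  have int: "integrable M (Y t)" "Y s \<in> borel_measurable M"
    using Y assms by (auto simp: martingale_def intro: borel_measurable_integrable)
  have "(\<integral>\<omega>. indicator B \<omega> * Y t \<omega> \<partial>M) = (\<integral>\<omega>. indicator B \<omega> * real_cond_exp M (F (ennreal s)) (Y t) \<omega> \<partial>M)"
    using real_cond_exp_intA[OF int(1) B] by (simp add: set_lebesgue_integral_def)
  also have "\<dots> = (\<integral>\<omega>. indicator B \<omega> * Y s \<omega> \<partial>M)"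
  proof (rule integral_cong_AE)
    have "AE \<omega> in M. real_cond_exp M (F (ennreal s)) (Y t) \<omega> = Y s \<omega>"
      using Y assms by (auto simp: martingale_def)
    then show "AE \<omega> in M. indicator B \<omega> * real_cond_exp M (F (ennreal s)) (Y t) \<omega> = indicator B \<omega> * Y s \<omega>"
      by eventually_elim simp
  qed (use int in measurable)
  finally show ?thesis by simp
qed

text \<open>
  On the grid, the stopped value is a conditional expectation of the terminal value \<open>Z\<close>; this gives
  both the expectation and a bound on the tails that is uniform in the mesh.
\<close>
lemma optional_stopping:
  assumes Y: "martingale M F Y"
    and rc: "AE \<omega> in M. \<forall>t\<ge>0. continuous (at_right t) (\<lambda>s. Y s \<omega>)"
    and S: "optional_time S" "\<And>\<omega>. S \<omega> \<le> m"
  shows "integrable M (\<lambda>\<omega>. Y (S \<omega>) \<omega>)"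
    and "(\<integral>\<omega>. Y (S \<omega>) \<omega> \<partial>M) = (\<integral>\<omega>. Y 0 \<omega> \<partial>M)"
proof -
  have S0: "0 \<le> S \<omega>" for \<omega> using S(1) by (rule optional_time_nonneg)
  then have m: "0 \<le> m" using S(2) by (meson order_trans)
  have S_less: "{\<omega> \<in> space M. S \<omega> < t} \<in> sets (F (ennreal t))" for t
    using S(1) by (rule optional_time_less)
  note [measurable] = optional_time_measurable[OF S(1)]
  have int_Y: "integrable M (Y t)" if "0 \<le> t" for t
    using Y that by (auto simp: martingale_def)
  then have Y_meas: "Y t \<in> borel_measurable M" if "0 \<le> t" for t
    using that by auto
  have adapted: "Y t \<in> borel_measurable (F (ennreal t))" if "0 \<le> t" for t
    using Y that by (auto simp: martingale_def adapted_def)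
  \<comment> \<open>All grid times exceed \<open>S \<le> m\<close> by at most 1, so
    \<open>m + 1\<close> is a terminal time common to all meshes.\<close>
  define Z where "Z = Y (m + 1)"
  have Z: "integrable M Z" using int_Y m by (simp add: Z_def)
  then have [measurable]: "Z \<in> borel_measurable M" by auto
  define V where "V k \<omega> = Y (grid k (S \<omega>)) \<omega>" for k \<omega>
  note eval = borel_measurable_eval[OF Y_meas rc optional_time_measurable[OF S(1)] S0]
  have [measurable]: "V k \<in> borel_measurable M" for k
    using eval(3)[of k] by (simp add: V_def[abs_def])
  define n where "n k \<omega> = nat \<lfloor>real (Suc k) * S \<omega>\<rfloor>" for k \<omega>
  have [measurable]: "n k \<in> measurable M (count_space UNIV)" for k
    unfolding n_def by measurable
  define q where "q k j = real (Suc j) / real (Suc k)" for k j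
  have V_eq: "V k \<omega> = Y (q k (n k \<omega>)) \<omega>" for k \<omega>
    by (simp add: V_def grid_def q_def n_def)
  have level: "{\<omega> \<in> space M. n k \<omega> = j} \<in> sets (F (ennreal (q k j)))" for k j
  proof -
    have "n k \<omega> = j \<longleftrightarrow> S \<omega> < q k j \<and> \<not> S \<omega> < real j / real (Suc k)" for \<omega>
    proof -
      have "n k \<omega> = j \<longleftrightarrow> \<lfloor>real (Suc k) * S \<omega>\<rfloor> = int j"
        using S0[of \<omega>] unfolding n_def by (auto simp: nat_eq_iff)
      also have "\<dots> \<longleftrightarrow> real j \<le> real (Suc k) * S \<omega> \<and> real (Suc k) * S \<omega> < real j + 1"
        by (simp add: floor_eq_iff)
      also have "\<dots> \<longleftrightarrow> S \<omega> < q k j \<and> \<not> S \<omega> < real j / real (Suc k)"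
        unfolding q_def by (auto simp: field_simps not_less)
      finally show ?thesis .
    qed
    then have "{\<omega> \<in> space M. n k \<omega> = j} = {\<omega> \<in> space M. S \<omega> < q k j} - {\<omega> \<in> space M. S \<omega> < real j / real (Suc k)}"
      by auto
    also have "\<dots> \<in> sets (F (ennreal (q k j)))"
    proof (rule sets.Diff)
      show "{\<omega> \<in> space M. S \<omega> < q k j} \<in> sets (F (ennreal (q k j)))"
        by (rule S_less)
      have "ennreal (real j / real (Suc k)) \<le> ennreal (q k j)"
        by (intro ennreal_leI) (auto simp: q_def intro!: divide_right_mono)
      then show "{\<omega> \<in> space M. S \<omega> < real j / real (Suc k)} \<in> sets (F (ennreal (q k j)))"
        by (rule subsetD[OF sets_F_mono S_less])
    qed
    finally show ?thesis .
  qed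
  have n_le: "n k \<omega> \<le> nat \<lfloor>real (Suc k) * m\<rfloor>" for k \<omega>
    unfolding n_def using S(2)[of \<omega>] by (intro nat_mono floor_mono mult_left_mono) auto
  have q_le: "q k j \<le> m + 1" if "j \<le> nat \<lfloor>real (Suc k) * m\<rfloor>" for k j
  proof -
    have "real j \<le> real (Suc k) * m"
      using that m by (simp add: le_nat_floor le_nat_iff le_floor_iff)
    then have "real (Suc j) \<le> (m + 1) * real (Suc k)"
      by (simp add: algebra_simps)
    then show ?thesis unfolding q_def by (simp add: divide_le_eq del: of_nat_Suc)
  qed
  have q0: "0 \<le> q k j" for k j by (simp add: q_def)
  have V_le: "\<bar>V k \<omega>\<bar> \<le> (\<Sum>j\<le>nat \<lfloor>real (Suc k) * m\<rfloor>. \<bar>Y (q k j) \<omega>\<bar>)" for k \<omega>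
    unfolding V_eq by (rule member_le_sum[where f = "\<lambda>j. \<bar>Y (q k j) \<omega>\<bar>"]) (use n_le in auto)
  have V_int: "integrable M (V k)" for k
    by (rule Bochner_Integration.integrable_bound[where f = "\<lambda>\<omega>. \<Sum>j\<le>nat \<lfloor>real (Suc k) * m\<rfloor>. \<bar>Y (q k j) \<omega>\<bar>"])
      (auto intro!: Bochner_Integration.integrable_sum integrable_abs int_Y q0 AE_I2 order_trans[OF V_le])
  \<comment> \<open>The condition on \<open>B\<close> says that it is known at the grid time. On
    each of the finitely many cells \<open>n k = j\<close> the grid time is a constant, where the
    martingale identity applies directly.\<close>
  have V_Z: "(\<integral>\<omega>. indicator B \<omega> * V k \<omega> \<partial>M) = (\<integral>\<omega>. indicator B \<omega> * Z \<omega> \<partial>M)"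
    if [measurable]: "B \<in> sets M" and B: "\<And>j. B \<inter> {\<omega> \<in> space M. n k \<omega> = j} \<in> sets (F (ennreal (q k j)))" for B k
  proof -
    let ?J = "{..nat \<lfloor>real (Suc k) * m\<rfloor>}" and ?B = "\<lambda>j. B \<inter> {\<omega> \<in> space M. n k \<omega> = j}"
    have split: "indicator B \<omega> * g (n k \<omega>) = (\<Sum>j\<in>?J. indicator (?B j) \<omega> * g j)" if "\<omega> \<in> space M"
      for \<omega> and g :: "nat \<Rightarrow> real"
    proof -
      have "(\<Sum>j\<in>?J. indicator (?B j) \<omega> * g j) = (\<Sum>j\<in>?J. if n k \<omega> = j then indicator B \<omega> * g j else 0)"
        using that by (intro sum.cong) (auto simp: indicator_def)
      then show ?thesis using n_le[of k \<omega>] by simp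
    qed
    have int: "integrable M (\<lambda>\<omega>. indicator (?B j) \<omega> * g \<omega>)" if "integrable M g" for j and g :: "'a \<Rightarrow> real"
      using integrable_mult_indicator[of "?B j" M g] that by simp
    have "(\<integral>\<omega>. indicator B \<omega> * V k \<omega> \<partial>M) = (\<integral>\<omega>. (\<Sum>j\<in>?J. indicator (?B j) \<omega> * Y (q k j) \<omega>) \<partial>M)"
      unfolding V_eq by (intro Bochner_Integration.integral_cong refl split)
    also have "\<dots> = (\<Sum>j\<in>?J. \<integral>\<omega>. indicator (?B j) \<omega> * Y (q k j) \<omega> \<partial>M)"
      by (intro Bochner_Integration.integral_sum int int_Y q0)
    also have "\<dots> = (\<Sum>j\<in>?J. \<integral>\<omega>. indicator (?B j) \<omega> * Z \<omega> \<partial>M)"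
      unfolding Z_def
      by (intro sum.cong refl martingale_set_integral[OF Y q0 _ B] q_le) auto
    also have "\<dots> = (\<integral>\<omega>. (\<Sum>j\<in>?J. indicator (?B j) \<omega> * Z \<omega>) \<partial>M)"
      by (intro Bochner_Integration.integral_sum[symmetric] int Z)
    also have "\<dots> = (\<integral>\<omega>. indicator B \<omega> * Z \<omega> \<partial>M)"
      by (intro Bochner_Integration.integral_cong refl split[symmetric])
    finally show ?thesis .
  qed
  have c: "(\<integral>\<omega>. V k \<omega> \<partial>M) = (\<integral>\<omega>. Y 0 \<omega> \<partial>M)" for k
  proof -
    have "(\<integral>\<omega>. indicator (space M) \<omega> * V k \<omega> \<partial>M) = (\<integral>\<omega>. indicator (space M) \<omega> * Z \<omega> \<partial>M)"
      using level[of k] by (intro V_Z) (auto simp: Int_def)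
    also have "\<dots> = (\<integral>\<omega>. indicator (space M) \<omega> * Y 0 \<omega> \<partial>M)"
      unfolding Z_def using m sets.top[of "F 0"]
      by (intro martingale_set_integral[OF Y, symmetric]) (auto simp: space_F)
    finally show ?thesis
      by (simp cong: Bochner_Integration.integral_cong)
  qed
  \<comment> \<open>The tail of \<open>V k\<close> is at most the mean of
    \<open>\<bar>Z\<bar>\<close> over \<open>\<bar>V k\<bar> > l\<close>. Where
    \<open>\<bar>Z\<bar> \<le> sqrt l\<close>, a Markov bound for the probability of that event
    gives the first summand; the rest is the second. Any threshold growing more slowly than
    \<open>l\<close> would do.\<close>
  define \<delta> where "\<delta> l = (\<integral>\<omega>. \<bar>Z \<omega>\<bar> \<partial>M) / sqrt l + (\<integral>\<omega>. \<bar>Z \<omega>\<bar> * indicator {sqrt l<..} \<bar>Z \<omega>\<bar> \<partial>M)" for l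
  have tail: "(\<integral>\<omega>. \<bar>V k \<omega>\<bar> * indicator {l<..} \<bar>V k \<omega>\<bar> \<partial>M) \<le> \<delta> l" if l: "0 < l" for k l
  proof -
    \<comment> \<open>\<open>V_Z\<close> is an identity for \<open>V k\<close>, not for its absolute
      value, so the two signs are treated on separate events.\<close>
    let ?P = "{\<omega> \<in> space M. l < V k \<omega>}" and ?N = "{\<omega> \<in> space M. V k \<omega> < - l}"
    let ?B = "{\<omega> \<in> space M. l < \<bar>V k \<omega>\<bar>}"
    have "?P \<inter> {\<omega> \<in> space M. n k \<omega> = j} = {\<omega> \<in> space (F (ennreal (q k j))). l < Y (q k j) \<omega>} \<inter> {\<omega> \<in> space M. n k \<omega> = j}" for j
      by (auto simp: V_eq space_F)
    then have P: "(\<integral>\<omega>. indicator ?P \<omega> * V k \<omega> \<partial>M) = (\<integral>\<omega>. indicator ?P \<omega> * Z \<omega> \<partial>M)"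
      using level[of k] adapted[OF q0] by (intro V_Z) auto
    have "?N \<inter> {\<omega> \<in> space M. n k \<omega> = j} = {\<omega> \<in> space (F (ennreal (q k j))). Y (q k j) \<omega> < - l} \<inter> {\<omega> \<in> space M. n k \<omega> = j}" for j
      by (auto simp: V_eq space_F)
    then have N: "(\<integral>\<omega>. indicator ?N \<omega> * V k \<omega> \<partial>M) = (\<integral>\<omega>. indicator ?N \<omega> * Z \<omega> \<partial>M)"
      using level[of k] adapted[OF q0] by (intro V_Z) auto
    have int: "integrable M (\<lambda>\<omega>. indicator B \<omega> * g \<omega>)" if "integrable M g" "B \<in> sets M" for B and g :: "'a \<Rightarrow> real"
      using integrable_mult_indicator[of B M g] that by simp
    have tail_int: "integrable M (\<lambda>\<omega>. \<bar>g \<omega>\<bar> * indicator {l<..} \<bar>g \<omega>\<bar>)" if "integrable M g" for g :: "'a \<Rightarrow> real" and l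
      by (rule Bochner_Integration.integrable_bound[OF that]) (use that in \<open>auto simp: indicator_def\<close>)
    have "(\<integral>\<omega>. \<bar>V k \<omega>\<bar> * indicator {l<..} \<bar>V k \<omega>\<bar> \<partial>M) = (\<integral>\<omega>. indicator ?P \<omega> * V k \<omega> - indicator ?N \<omega> * V k \<omega> \<partial>M)"
      using l by (intro Bochner_Integration.integral_cong) (auto simp: indicator_def)
    also have "\<dots> = (\<integral>\<omega>. indicator ?P \<omega> * Z \<omega> - indicator ?N \<omega> * Z \<omega> \<partial>M)"
      using V_int[of k] Z by (simp add: P N int)
    also have "\<dots> \<le> (\<integral>\<omega>. indicator ?B \<omega> * \<bar>Z \<omega>\<bar> \<partial>M)"
      using Z l by (intro integral_mono Bochner_Integration.integrable_diff int integrable_abs)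
        (auto simp: indicator_def)
    finally have le: "(\<integral>\<omega>. \<bar>V k \<omega>\<bar> * indicator {l<..} \<bar>V k \<omega>\<bar> \<partial>M) \<le> (\<integral>\<omega>. indicator ?B \<omega> * \<bar>Z \<omega>\<bar> \<partial>M)" .
    have int_BZ: "integrable M (\<lambda>\<omega>. indicator ?B \<omega> * \<bar>Z \<omega>\<bar>)"
      by (intro int integrable_abs Z) measurable
    have int_B: "integrable M (\<lambda>\<omega>. b * indicator ?B \<omega>)" for b :: real
      by (intro integrable_mult_right integrable_real_indicator) (auto simp: emeasure_eq_measure)
    have "l * prob ?B = (\<integral>\<omega>. l * indicator ?B \<omega> \<partial>M)"
      by simp
    also have "\<dots> \<le> (\<integral>\<omega>. \<bar>V k \<omega>\<bar> * indicator {l<..} \<bar>V k \<omega>\<bar> \<partial>M)"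
      by (rule integral_mono[OF int_B tail_int[OF V_int]]) (auto simp: indicator_def)
    also have "\<dots> \<le> (\<integral>\<omega>. indicator ?B \<omega> * \<bar>Z \<omega>\<bar> \<partial>M)" by (rule le)
    also have "\<dots> \<le> (\<integral>\<omega>. \<bar>Z \<omega>\<bar> \<partial>M)"
      by (rule integral_mono[OF int_BZ integrable_abs[OF Z]]) (auto simp: indicator_def)
    finally have "prob ?B \<le> (\<integral>\<omega>. \<bar>Z \<omega>\<bar> \<partial>M) / l"
      using l by (simp add: le_divide_eq mult.commute)
    then have "sqrt l * prob ?B \<le> sqrt l * ((\<integral>\<omega>. \<bar>Z \<omega>\<bar> \<partial>M) / l)"
      using l by (intro mult_left_mono) auto
    also have "\<dots> = (\<integral>\<omega>. \<bar>Z \<omega>\<bar> \<partial>M) / sqrt l"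
    proof -
      have "r * (z / (r * r)) = z / r" if "0 < r" for r z :: real
        using that by simp
      from this[of "sqrt l"] show ?thesis using l by simp
    qed
    finally have prob: "sqrt l * prob ?B \<le> (\<integral>\<omega>. \<bar>Z \<omega>\<bar> \<partial>M) / sqrt l" .
    have "(\<integral>\<omega>. indicator ?B \<omega> * \<bar>Z \<omega>\<bar> \<partial>M) \<le> (\<integral>\<omega>. sqrt l * indicator ?B \<omega> + \<bar>Z \<omega>\<bar> * indicator {sqrt l<..} \<bar>Z \<omega>\<bar> \<partial>M)"
      by (rule integral_mono[OF int_BZ Bochner_Integration.integrable_add[OF int_B tail_int[OF Z]]])
        (use l in \<open>simp add: indicator_def\<close>)
    also have "\<dots> = sqrt l * prob ?B + (\<integral>\<omega>. \<bar>Z \<omega>\<bar> * indicator {sqrt l<..} \<bar>Z \<omega>\<bar> \<partial>M)"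
      by (subst Bochner_Integration.integral_add[OF int_B tail_int[OF Z]]) simp
    also have "\<dots> \<le> \<delta> l"
      using prob by (simp add: \<delta>_def)
    finally show ?thesis using le by simp
  qed
  have \<delta>: "(\<delta> \<longlongrightarrow> 0) at_top"
  proof -
    have "((\<lambda>l. \<integral>\<omega>. \<bar>Z \<omega>\<bar> * indicator {sqrt l<..} \<bar>Z \<omega>\<bar> \<partial>M) \<longlongrightarrow> (\<integral>\<omega>. 0 \<partial>M)) at_top"
    proof (rule integral_dominated_convergence_at_top[where w = "\<lambda>\<omega>. \<bar>Z \<omega>\<bar>"])
      show "AE \<omega> in M. ((\<lambda>l. \<bar>Z \<omega>\<bar> * indicator {sqrt l<..} \<bar>Z \<omega>\<bar>) \<longlongrightarrow> 0) at_top"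
      proof (rule AE_I2)
        fix \<omega>
        have "eventually (\<lambda>l. \<bar>Z \<omega>\<bar> \<le> sqrt l) at_top"
          using sqrt_at_top by (auto simp: filterlim_at_top)
        then have "eventually (\<lambda>l. \<bar>Z \<omega>\<bar> * indicator {sqrt l<..} \<bar>Z \<omega>\<bar> = 0) at_top"
          by (rule eventually_mono) (simp add: indicator_def)
        then show "((\<lambda>l. \<bar>Z \<omega>\<bar> * indicator {sqrt l<..} \<bar>Z \<omega>\<bar>) \<longlongrightarrow> 0) at_top"
          by (rule tendsto_eventually)
      qed
      show "\<forall>\<^sub>F l in at_top. AE \<omega> in M. norm (\<bar>Z \<omega>\<bar> * indicator {sqrt l<..} \<bar>Z \<omega>\<bar>) \<le> \<bar>Z \<omega>\<bar>"
        by (intro always_eventually allI AE_I2) (simp add: indicator_def)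
      show "integrable M (\<lambda>\<omega>. \<bar>Z \<omega>\<bar>)" using Z by (rule integrable_abs)
    qed measurable
    then have "(\<delta> \<longlongrightarrow> 0 + 0) at_top"
      unfolding \<delta>_def
      by (intro tendsto_add real_tendsto_divide_at_top[OF tendsto_const sqrt_at_top]) simp
    then show ?thesis by simp
  qed
  have "AE \<omega> in M. (\<lambda>k. V k \<omega>) \<longlonglongrightarrow> Y (S \<omega>) \<omega>"
    using eval(2) unfolding V_def .
  note limit = uniformly_integrable_integral_limit[OF V_int eval(1) this c tail \<delta>]
  show "integrable M (\<lambda>\<omega>. Y (S \<omega>) \<omega>)" "(\<integral>\<omega>. Y (S \<omega>) \<omega> \<partial>M) = (\<integral>\<omega>. Y 0 \<omega> \<partial>M)"
    by (rule limit; assumption)+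
qed

end

section \<open>Paths of class Sigma\<close>

lemma continuous_on_atLeast_tendsto:
  fixes a :: "real \<Rightarrow> real"
  assumes "continuous_on {b..} a"
  shows "b < t \<Longrightarrow> (a \<longlongrightarrow> a t) (at_left t)" and "b \<le> t \<Longrightarrow> (a \<longlongrightarrow> a t) (at_right t)"
proof -
  assume t: "b < t"
  then have "(a \<longlongrightarrow> a t) (at t within {b..})"
    using assms by (simp add: continuous_on_def)
  then have "(a \<longlongrightarrow> a t) (at t within {b..t})"
    by (rule tendsto_within_subset) auto
  then show "(a \<longlongrightarrow> a t) (at_left t)"
    by (simp add: at_within_Icc_at_left[OF t])
next
  assume t: "b \<le> t"
  then have "(a \<longlongrightarrow> a t) (at t within {b..})"
    using assms by (simp add: continuous_on_def)
  then show "(a \<longlongrightarrow> a t) (at_right t)"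
    by (rule tendsto_within_subset) (use t in auto)
qed

text \<open>The measure charges \<open>{p<..r}\<close> with the increment of \<open>a\<close>, while
  almost every point of it is a zero of \<open>x\<close>, and there are none in there. Since
  \<open>x q\<close> may vanish, \<open>r\<close> stays below \<open>q\<close>, and continuity of
  \<open>a\<close> reaches the endpoint.\<close>

lemma stieltjes_null_flat:
  fixes a x :: "real \<Rightarrow> real"
  assumes cont: "continuous_on {0..} a" and mono: "mono_on {0..} a"
    and AE: "AE t in stieltjes a. t \<ge> 0 \<longrightarrow> x t = 0"
    and pq: "0 \<le> p" "p < q" and x: "\<And>t. p < t \<Longrightarrow> t < q \<Longrightarrow> x t \<noteq> 0"
  shows "a p = a q"
proof -
  let ?a = "\<lambda>t. a (max 0 t)"
  have "continuous_on UNIV ?a"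
    by (rule continuous_on_compose2[OF cont]) (auto intro!: continuous_intros)
  then have rc: "continuous (at_right t) ?a" for t
    by (meson UNIV_I continuous_on_eq_continuous_within continuous_within_subset top_greatest)
  have mono': "?a s \<le> ?a t" if "s \<le> t" for s t
    using mono that by (auto simp: mono_on_def)
  have flat: "a r = a p" if r: "p < r" "r < q" for r
  proof -
    have "AE t in stieltjes a. t \<notin> {p<..r}"
      using AE x r pq by (auto elim!: eventually_mono)
    then have "emeasure (stieltjes a) {p<..r} = 0"
      by (subst (asm) AE_iff_measurable[of "{p<..r}"]) (auto simp: stieltjes_def)
    moreover have "emeasure (stieltjes a) {p<..r} = ennreal (?a r - ?a p)"
      unfolding stieltjes_def using r by (intro emeasure_interval_measure_Ioc mono' rc) auto
    ultimately have "?a r \<le> ?a p"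
      by (simp add: ennreal_eq_0_iff)
    then show ?thesis
      using mono'[of p r] r pq by simp
  qed
  have "(a \<longlongrightarrow> a q) (at_left q)"
    using pq by (intro continuous_on_atLeast_tendsto(1)[OF cont]) auto
  moreover have "eventually (\<lambda>r. a r = a p) (at_left q)"
    unfolding eventually_at_left_field using pq flat by blast
  then have "(a \<longlongrightarrow> a p) (at_left q)"
    by (rule tendsto_eventually)
  ultimately show ?thesis
    using tendsto_unique[OF trivial_limit_at_left_real] by metis
qed

text \<open>Collects what almost every trajectory satisfies, so that the passage arguments become
  deterministic. The carrying condition on the measure of \<open>A\<close> enters as
  \<open>flat\<close>, the sign of the jumps as \<open>x_left\<close>.\<close>

locale sigma_path =
  fixes x a :: "real \<Rightarrow> real"
  assumes x_nonneg: "\<And>t. 0 \<le> t \<Longrightarrow> 0 \<le> x t" and x_0: "x 0 = 0"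
    and x_right: "\<And>t. 0 \<le> t \<Longrightarrow> (x \<longlongrightarrow> x t) (at_right t)"
    and x_left: "\<And>t. 0 < t \<Longrightarrow> \<exists>l. (x \<longlongrightarrow> l) (at_left t) \<and> x t \<le> l"
    and a_cont: "continuous_on {0..} a" and a_mono: "\<And>s t. 0 \<le> s \<Longrightarrow> s \<le> t \<Longrightarrow> a s \<le> a t"
    and a_0: "a 0 = 0" and a_top: "filterlim a at_top at_top"
    and flat: "\<And>p q. 0 \<le> p \<Longrightarrow> p < q \<Longrightarrow> (\<And>t. p < t \<Longrightarrow> t < q \<Longrightarrow> x t \<noteq> 0) \<Longrightarrow> a p = a q"
begin

lemma a_nonneg: "0 \<le> t \<Longrightarrow> 0 \<le> a t"
  using a_mono[of 0 t] a_0 by simp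

lemmas a_left = continuous_on_atLeast_tendsto(1)[OF a_cont]
  and a_right = continuous_on_atLeast_tendsto(2)[OF a_cont]

lemma a_flat_right:
  assumes "0 \<le> t" "0 < x t"
  shows "eventually (\<lambda>s. a s = a t) (at_right t)"
proof -
  obtain b where b: "t < b" "\<And>y. t < y \<Longrightarrow> y < b \<Longrightarrow> 0 < x y"
    using order_tendstoD(1)[OF x_right[OF assms(1)] assms(2)] unfolding eventually_at_right_field by auto
  have "a t = a s" if "t < s" "s < b" for s
    using flat[OF assms(1) that(1)] b that by fastforce
  then show ?thesis
    unfolding eventually_at_right_field using b by (intro exI[of _ b]) auto
qed

text \<open>During an excess \<open>x\<close> is positive, so \<open>a\<close> is frozen just
  afterwards and with it the barrier \<open>\<phi> (a t)\<close>, however irregular \<phi> is.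
  Right-continuity of \<open>x\<close> against a constant then suffices.\<close>

lemma exceed_right:
  assumes "0 \<le> t" "\<phi> (a t) < x t" "0 \<le> \<phi> (a t)"
  shows "eventually (\<lambda>s. a s = a t \<and> \<phi> (a s) < x s) (at_right t)"
  using order_tendstoD(1)[OF x_right[OF assms(1)] assms(2)] a_flat_right[of t] assms
  by (auto elim: eventually_elim2)

lemma level_nonempty: "\<exists>t\<ge>0. u < a t"
proof -
  have "eventually (\<lambda>t. u < a t \<and> 0 \<le> t) at_top"
    using a_top by (intro eventually_conj eventually_ge_at_top) (auto simp: filterlim_at_top_dense)
  from eventually_happens'[OF trivial_limit_at_top_linorder this] show ?thesis by auto
qed

text \<open>Continuity gives \<open>a s = u\<close>. If \<open>x s\<close> were positive,
  \<open>a\<close> would remain equal to \<open>u\<close> just after \<open>s\<close>, whereas it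
  exceeds \<open>u\<close> there; hence \<open>x\<close> vanishes at every inverse time.\<close>

lemma inverse_level:
  assumes "0 \<le> u"
  defines "s \<equiv> Inf {t. 0 \<le> t \<and> u < a t}"
  shows "0 \<le> s" "a s = u" "x s = 0" "\<And>t. 0 \<le> t \<Longrightarrow> u < a t \<longleftrightarrow> s < t"
proof -
  let ?K = "{t. 0 \<le> t \<and> u < a t}"
  have K: "?K \<noteq> {}" "bdd_below ?K"
    using level_nonempty[of u] by (auto intro: bdd_belowI[of _ 0])
  show s0: "0 \<le> s"
    unfolding s_def using K by (intro cInf_greatest) auto
  have above: "u < a t" if "s < t" for t
  proof -
    obtain r where "0 \<le> r" "u < a r" "r < t"
      using \<open>s < t\<close> unfolding s_def cInf_less_iff[OF K] by auto
    then show ?thesis using a_mono[of r t] by simp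
  qed
  have below: "a t \<le> u" if "0 \<le> t" "t < s" for t
    using that cInf_lower[OF _ K(2), of t] unfolding s_def by force
  have "a s \<le> u"
  proof (cases "s = 0")
    case True
    then show ?thesis using a_0 assms by simp
  next
    case False
    then have "eventually (\<lambda>t. a t \<le> u) (at_left s)"
      using s0 below unfolding eventually_at_left_field by (intro exI[of _ 0]) auto
    then show ?thesis
      using False s0 by (intro tendsto_upperbound[OF a_left]) auto
  qed
  moreover have "eventually (\<lambda>t. u \<le> a t) (at_right s)"
    using above unfolding eventually_at_right_field by (intro exI[of _ "s + 1"]) (auto intro: less_imp_le)
  then have "u \<le> a s"
    by (intro tendsto_lowerbound[OF a_right[OF s0]]) auto
  ultimately show as: "a s = u" by simp
  show level: "u < a t \<longleftrightarrow> s < t" if "0 \<le> t" for t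
    using above[of t] below[of t] as that by (cases t s rule: linorder_cases) auto
  show "x s = 0"
  proof (rule ccontr)
    assume "x s \<noteq> 0"
    then have "eventually (\<lambda>t. a t = a s) (at_right s)"
      using x_nonneg[OF s0] by (intro a_flat_right s0) auto
    moreover have "eventually (\<lambda>t. s < t) (at_right s)"
      by (rule eventually_at_right_less)
    ultimately have "eventually (\<lambda>t. False) (at_right s)"
      by eventually_elim (use above as in force)
    then show False by simp
  qed
qed

text \<open>
  Absence of positive jumps forbids jumping over the level \<open>\<phi> (a s)\<close>; the hypothesis \<open>\<delta> > 0\<close>
  keeps the first passage strictly inside an excursion, where \<open>a\<close> is constant.
\<close>
lemma first_passage:
  assumes \<phi>: "\<And>y. \<delta> \<le> \<phi> y" "0 < \<delta>"
    and ne: "\<exists>t\<ge>0. a t \<le> u \<and> \<phi> (a t) < x t"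
  defines "s \<equiv> Inf {t. 0 \<le> t \<and> a t \<le> u \<and> \<phi> (a t) < x t}"
  shows "0 \<le> s" "a s \<le> u" "x s = \<phi> (a s)"
proof -
  let ?H = "{t. 0 \<le> t \<and> a t \<le> u \<and> \<phi> (a t) < x t}"
  have H: "?H \<noteq> {}" "bdd_below ?H"
    using ne by (auto intro: bdd_belowI[of _ 0])
  show s0: "0 \<le> s"
    unfolding s_def using H by (intro cInf_greatest) auto
  have lower: "s \<le> t" if "t \<in> ?H" for t
    unfolding s_def using cInf_lower[OF that H(2)] .
  show "a s \<le> u"
    using ne lower s0 by (auto intro: order_trans[OF a_mono])
  \<comment> \<open>Either the infimum is attained or members of the set lie arbitrarily close to
    its right; both cases are covered at once.\<close>
  have near: "\<exists>t\<in>?H. s \<le> t \<and> (t = s \<or> P t)" if P: "eventually P (at_right s)" for P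
  proof -
    obtain b where b: "s < b" "\<And>y. s < y \<Longrightarrow> y < b \<Longrightarrow> P y"
      using P unfolding eventually_at_right_field by auto
    from b(1) obtain t where "t \<in> ?H" "t < b"
      unfolding s_def cInf_less_iff[OF H] by auto
    moreover from \<open>t \<in> ?H\<close> have "s \<le> t" by (rule lower)
    ultimately show ?thesis
      using b(2)[of t] by (intro bexI[of _ t]) (auto simp: le_less)
  qed
  \<comment> \<open>This comes before any comparison with \<open>\<phi> (a s)\<close>: only
    positivity of \<open>x s\<close> makes \<open>a\<close>, and hence the barrier, constant just
    after \<open>s\<close>. The uniform bound \<delta> gives positivity without knowing the barrier
    there.\<close>
  have "\<delta> \<le> x s"
  proof (rule ccontr)
    assume "\<not> \<delta> \<le> x s"
    then have "eventually (\<lambda>t. x t < \<delta>) (at_right s)"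
      by (intro order_tendstoD(2)[OF x_right[OF s0]]) auto
    from near[OF this] \<open>\<not> \<delta> \<le> x s\<close> obtain t where "x t < \<delta>" "\<phi> (a t) < x t"
      by (auto simp: not_le)
    then show False using \<phi>(1)[of "a t"] by simp
  qed
  then have xs: "0 < x s" using \<phi>(2) by simp
  have ge: "\<phi> (a s) \<le> x s"
  proof (rule ccontr)
    assume *: "\<not> \<phi> (a s) \<le> x s"
    then have "eventually (\<lambda>t. x t < \<phi> (a s)) (at_right s)"
      by (intro order_tendstoD(2)[OF x_right[OF s0]]) auto
    then have "eventually (\<lambda>t. x t < \<phi> (a s) \<and> a t = a s) (at_right s)"
      using a_flat_right[OF s0 xs] by (rule eventually_conj)
    from near[OF this] show False using * by auto
  qed
  have le: "x s \<le> \<phi> (a s)"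
  proof (rule ccontr)
    assume "\<not> x s \<le> \<phi> (a s)"
    then have gt: "\<phi> (a s) < x s" by simp
    have "0 < s" using x_0 xs s0 by (cases "s = 0") auto
    then obtain l where l: "(x \<longlongrightarrow> l) (at_left s)" "x s \<le> l"
      using x_left by auto
    then have "eventually (\<lambda>t. \<phi> (a s) < x t) (at_left s)"
      using gt by (intro order_tendstoD(1)[OF l(1)]) auto
    then obtain b where b: "b < s" "\<And>y. b < y \<Longrightarrow> y < s \<Longrightarrow> \<phi> (a s) < x y"
      unfolding eventually_at_left_field by auto
    obtain t where t: "max 0 b < t" "t < s"
      using dense[of "max 0 b" s] b \<open>0 < s\<close> by auto
    \<comment> \<open>The left limit lies above the barrier, so \<open>x\<close> is positive on the
      whole interval from \<open>t\<close> to \<open>s\<close>. Flatness makes the barrier at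
      \<open>t\<close> equal to \<open>\<phi> (a s)\<close>, so \<open>t\<close> would be an earlier
      passage.\<close>
    have "a t = a s"
    proof (rule flat)
      fix r assume "t < r" "r < s"
      then have "\<phi> (a s) < x r" using b(2)[of r] t by simp
      then show "x r \<noteq> 0" using \<phi>(1)[of "a s"] \<phi>(2) by simp
    qed (use t in auto)
    then have "t \<in> ?H"
      using t b(2)[of t] \<open>a s \<le> u\<close> by auto
    then show False using lower t by fastforce
  qed
  show "x s = \<phi> (a s)" using ge le by simp
qed

text \<open>By monotonicity a time with \<open>a\<close> above \<open>u\<close> comes after every
  passage below that level. So the combined infimum is the first passage if there is one, and the
  inverse of \<open>a\<close> at \<open>u\<close> otherwise; including the level crossing makes it
  meaningful on every path. The last bound extends to the endpoint, which does not belong to the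
  set.\<close>

lemma passage_cases:
  assumes \<phi>: "\<And>y. \<delta> \<le> \<phi> y" "0 < \<delta>" and u: "0 \<le> u"
  defines "s \<equiv> Inf {t. 0 \<le> t \<and> (u < a t \<or> \<phi> (a t) < x t)}"
  shows "0 \<le> s"
    and "(\<exists>t\<ge>0. a t \<le> u \<and> \<phi> (a t) < x t) \<Longrightarrow> x s = \<phi> (a s)"
    and "\<not> (\<exists>t\<ge>0. a t \<le> u \<and> \<phi> (a t) < x t) \<Longrightarrow> x s = 0 \<and> a s = u"
    and "\<And>t. 0 \<le> t \<Longrightarrow> t \<le> s \<Longrightarrow> a t \<le> u \<and> x t \<le> \<phi> (a t)"
proof -
  let ?K = "{t. 0 \<le> t \<and> (u < a t \<or> \<phi> (a t) < x t)}"
  let ?H = "{t. 0 \<le> t \<and> a t \<le> u \<and> \<phi> (a t) < x t}"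
  let ?E = "\<exists>t\<ge>0. a t \<le> u \<and> \<phi> (a t) < x t"
  have K: "?K \<noteq> {}" "bdd_below ?K"
    using level_nonempty[of u] by (auto intro: bdd_belowI[of _ 0])
  show s0: "0 \<le> s"
    unfolding s_def using K by (intro cInf_greatest) auto
  have E: "a s \<le> u \<and> x s = \<phi> (a s)" if ?E
  proof -
    have H: "?H \<noteq> {}" "bdd_below ?H"
      using that by (auto intro: bdd_belowI[of _ 0])
    have "Inf ?H \<le> Inf ?K"
    proof (rule cInf_greatest[OF K(1)])
      fix k assume k: "k \<in> ?K"
      show "Inf ?H \<le> k"
      proof (cases "k \<in> ?H")
        case True
        then show ?thesis using cInf_lower[OF _ H(2)] by simp
      next
        case False
        then have "0 \<le> k" "u < a k" using k by auto
        obtain h where h: "h \<in> ?H" using H by blast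
        have "h \<le> k"
          using h \<open>0 \<le> k\<close> \<open>u < a k\<close> a_mono[of k h] by (cases "h \<le> k") auto
        then show ?thesis using cInf_lower[OF h H(2)] by simp
      qed
    qed
    moreover have "Inf ?K \<le> Inf ?H"
      by (rule cInf_superset_mono[OF H(1) K(2)]) auto
    ultimately have "s = Inf ?H" unfolding s_def by simp
    then show ?thesis using first_passage[OF \<phi> that] by simp
  qed
  have nE: "a s = u \<and> x s = 0" if "\<not> ?E"
  proof -
    have "?K = {t. 0 \<le> t \<and> u < a t}" using that by force
    then show ?thesis using inverse_level[OF u] by (simp add: s_def)
  qed
  show "?E \<Longrightarrow> x s = \<phi> (a s)" "\<not> ?E \<Longrightarrow> x s = 0 \<and> a s = u"
    using E nE by auto
  have "a s \<le> u" "x s \<le> \<phi> (a s)"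
    using E nE \<phi>(1)[of "a s"] \<phi>(2) by (cases ?E; force)+
  moreover have "a t \<le> u \<and> x t \<le> \<phi> (a t)" if "0 \<le> t" "t < s" for t
    using that cInf_lower[OF _ K(2), of t] unfolding s_def by force
  ultimately show "a t \<le> u \<and> x t \<le> \<phi> (a t)" if "0 \<le> t" "t \<le> s" for t
    using that by (cases "t = s") auto
qed

end

section \<open>The level identity\<close>

text \<open>
  The hypothesis determines the measure \<open>B \<mapsto> E[W; Z \<in> B]\<close> on the intervals \<open>(a,\<infinity>)\<close>, hence on all
  Borel sets.
\<close>
lemma (in prob_space) nn_integral_level_identity:
  fixes W Z :: "'a \<Rightarrow> real" and h :: "real \<Rightarrow> ennreal"
  assumes [measurable]: "W \<in> borel_measurable M" "integrable M Z" "h \<in> borel_measurable borel"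
    and Z: "AE \<omega> in M. 0 \<le> Z \<omega>"
    and eq: "\<And>a. (\<integral>\<^sup>+\<omega>. ennreal (W \<omega>) * indicator {a<..} (Z \<omega>) \<partial>M) = (\<integral>\<^sup>+\<omega>. ennreal (Z \<omega> - max 0 a) \<partial>M)"
  shows "(\<integral>\<^sup>+\<omega>. h (Z \<omega>) * ennreal (W \<omega>) \<partial>M) = (\<integral>\<^sup>+\<omega>. (\<integral>\<^sup>+x\<in>{0..Z \<omega>}. h x \<partial>lborel) \<partial>M)"
proof -
  have [measurable]: "Z \<in> borel_measurable M" using assms(2) by auto
  define \<mu> where "\<mu> = distr (density M (\<lambda>\<omega>. ennreal (W \<omega>))) borel Z"
  \<comment> \<open>\<open>D\<close> is the product measure restricted to the region under the graph
    of \<open>Z\<close>; its projection \<nu> assigns to a set the mean length of its part in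
    \<open>{0..Z \<omega>}\<close>, which is the right-hand side.\<close>
  define D where "D = density (M \<Otimes>\<^sub>M lborel) (\<lambda>(\<omega>, x). indicator {0..Z \<omega>} x :: ennreal)"
  define \<nu> where "\<nu> = distr D borel snd"
  have [measurable]: "(\<lambda>(\<omega>, x). indicator {0..Z \<omega>} x :: ennreal) \<in> borel_measurable (M \<Otimes>\<^sub>M lborel)"
    unfolding indicator_def atLeastAtMost_iff by measurable
  have D_sets [measurable_cong]: "sets D = sets (M \<Otimes>\<^sub>M borel)"
    by (simp add: D_def)
  have \<mu>_int: "(\<integral>\<^sup>+x. g x \<partial>\<mu>) = (\<integral>\<^sup>+\<omega>. g (Z \<omega>) * ennreal (W \<omega>) \<partial>M)"
    if [measurable]: "g \<in> borel_measurable borel" for g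
    unfolding \<mu>_def by (simp add: nn_integral_distr nn_integral_density mult.commute)
  have \<nu>_int: "(\<integral>\<^sup>+x. g x \<partial>\<nu>) = (\<integral>\<^sup>+\<omega>. (\<integral>\<^sup>+x\<in>{0..Z \<omega>}. g x \<partial>lborel) \<partial>M)"
    if [measurable]: "g \<in> borel_measurable borel" for g
  proof -
    have "(\<integral>\<^sup>+x. g x \<partial>\<nu>) = (\<integral>\<^sup>+p. g (snd p) \<partial>D)"
      unfolding \<nu>_def by (rule nn_integral_distr) measurable
    also have "\<dots> = (\<integral>\<^sup>+p. (case p of (\<omega>, x) \<Rightarrow> indicator {0..Z \<omega>} x) * g (snd p) \<partial>(M \<Otimes>\<^sub>M lborel))"
      unfolding D_def by (rule nn_integral_density) measurable
    also have "\<dots> = (\<integral>\<^sup>+\<omega>. \<integral>\<^sup>+x. indicator {0..Z \<omega>} x * g x \<partial>lborel \<partial>M)"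
      by (subst lborel.nn_integral_fst[symmetric]) (auto intro!: nn_integral_cong)
    finally show ?thesis by (simp add: mult.commute)
  qed
  have "\<mu> = \<nu>"
  proof (rule measure_eqI_lessThan)
    show "sets \<mu> = sets borel" "sets \<nu> = sets borel"
      by (simp_all add: \<mu>_def \<nu>_def)
    fix a :: real
    have m: "emeasure \<mu> {a<..} = (\<integral>\<^sup>+\<omega>. ennreal (Z \<omega> - max 0 a) \<partial>M)"
      using \<mu>_int[of "indicator {a<..}"] eq[of a]
      by (simp add: nn_integral_indicator \<mu>_def mult.commute)
    have "(\<integral>\<^sup>+\<omega>. ennreal (Z \<omega> - max 0 a) \<partial>M) \<le> (\<integral>\<^sup>+\<omega>. ennreal (norm (Z \<omega>)) \<partial>M)"
      by (intro nn_integral_mono ennreal_leI) auto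
    also have "\<dots> < \<infinity>"
      using assms(2) unfolding integrable_iff_bounded by blast
    finally show "emeasure \<mu> {a<..} < \<infinity>"
      by (simp add: m)
    have "(\<integral>\<^sup>+x\<in>{0..z}. indicator {a<..} x \<partial>lborel) = ennreal (z - max 0 a)" if "0 \<le> z" for z
    proof -
      have "(\<integral>\<^sup>+x\<in>{0..z}. indicator {a<..} x \<partial>lborel) = emeasure lborel ({a<..} \<inter> {0..z})"
        by (simp add: nn_integral_indicator flip: indicator_inter_arith)
      \<comment> \<open>The \<open>max\<close> handles half-lines starting below 0; for
        \<open>z < a\<close> the negative difference is sent to 0 by \<open>ennreal\<close>.\<close>
      also have "\<dots> = ennreal (z - max 0 a)"
      proof (cases "a < 0")
        case True
        then have "{a<..} \<inter> {0..z} = {0..z}" by auto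
        then show ?thesis using True that by simp
      next
        case False
        then have "{a<..} \<inter> {0..z} = {a<..z}" by auto
        then show ?thesis using False
          by (cases "a \<le> z") (auto simp: ennreal_neg)
      qed
      finally show ?thesis .
    qed
    with Z have "AE \<omega> in M. (\<integral>\<^sup>+x\<in>{0..Z \<omega>}. indicator {a<..} x \<partial>lborel) = ennreal (Z \<omega> - max 0 a)"
      by (auto elim!: eventually_mono)
    from nn_integral_cong_AE[OF this] show "emeasure \<mu> {a<..} = emeasure \<nu> {a<..}"
      using \<nu>_int[of "indicator {a<..}"]
      by (simp add: m nn_integral_indicator \<nu>_def)
  qed
  then show ?thesis
    using \<mu>_int[of h] \<nu>_int[of h] by simp
qed

section \<open>Stopped paths and the almost sure properties of the processes\<close>

lemma enn2real_min_ennreal: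
  assumes "0 \<le> s"
  shows "enn2real (min (ennreal s) T) = (if T = \<infinity> then s else min s (enn2real T))"
proof (cases T)
  case (real r)
  then show ?thesis using assms by (auto simp: min_def ennreal_le_iff)
next
  case top
  then show ?thesis using assms by simp
qed

text \<open>To the right of \<open>t\<close> the stopped path either agrees with \<open>x\<close>
  for a while, when \<open>T\<close> is still ahead, or is constant.\<close>

lemma continuous_at_right_stopped:
  fixes x :: "real \<Rightarrow> real"
  assumes "\<And>t. 0 \<le> t \<Longrightarrow> (x \<longlongrightarrow> x t) (at_right t)" "0 \<le> t"
  shows "continuous (at_right t) (\<lambda>s. x (enn2real (min (ennreal s) T)))"
proof -
  have "((\<lambda>s. x (enn2real (min (ennreal s) T))) \<longlongrightarrow> x (enn2real (min (ennreal t) T))) (at_right t)"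
  proof (cases "T = \<infinity> \<or> t < enn2real T")
    case True
    then obtain b where b: "t < b" "\<And>s. t \<le> s \<Longrightarrow> s < b \<Longrightarrow> enn2real (min (ennreal s) T) = s"
    proof
      assume "T = \<infinity>"
      then show thesis
        using \<open>0 \<le> t\<close> by (intro that[of "t + 1"]) (auto simp: enn2real_min_ennreal)
    next
      assume "t < enn2real T"
      then show thesis
        using \<open>0 \<le> t\<close> by (intro that[of "enn2real T"]) (auto simp: enn2real_min_ennreal)
    qed
    have "eventually (\<lambda>s. x (enn2real (min (ennreal s) T)) = x s) (at_right t)"
      unfolding eventually_at_right_field using b by (intro exI[of _ b]) auto
    then show ?thesis
      using assms b by (simp add: tendsto_cong)
  next
    case False
    then have "enn2real (min (ennreal s) T) = enn2real T" if "t \<le> s" for s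
      using that \<open>0 \<le> t\<close> by (auto simp: enn2real_min_ennreal)
    then show ?thesis
      by (intro tendsto_eventually) (auto simp: eventually_at_filter)
  qed
  then show ?thesis by (simp add: continuous_within)
qed

locale sigma_process = usual_conditions M F
  for M :: "'a measure" and F +
  fixes X N A :: "real \<Rightarrow> 'a \<Rightarrow> real"
  assumes class_Sigma: "class_Sigma M F X N A"
    and only_negative_jumps: "only_negative_jumps M X"
    and A_top: "AE \<omega> in M. filterlim (\<lambda>t. A t \<omega>) at_top at_top"
begin

lemma adapted_X: "0 \<le> t \<Longrightarrow> X t \<in> borel_measurable (F (ennreal t))"
  and adapted_A: "0 \<le> t \<Longrightarrow> A t \<in> borel_measurable (F (ennreal t))"
  using class_Sigma unfolding class_Sigma_def local_submartingale_def adapted_def by blast+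

text \<open>\<open>Lim\<close> denotes the left limit of \<open>X\<close> only once such a limit is
  known to exist. It exists because \<open>N\<close> is cadlag and \<open>A\<close> is continuous,
  and then the jump condition gives \<open>x_left\<close>.\<close>

lemma AE_path:
  "AE \<omega> in M. sigma_path (\<lambda>t. X t \<omega>) (\<lambda>t. A t \<omega>) \<and> (\<forall>t\<ge>0. X t \<omega> = N t \<omega> + A t \<omega>) \<and>
     (\<forall>t\<ge>0. ((\<lambda>s. N s \<omega>) \<longlongrightarrow> N t \<omega>) (at_right t)) \<and> N 0 \<omega> = 0"
proof -
  have "AE \<omega> in M. \<forall>t\<ge>0. X t \<omega> \<ge> 0"
    "AE \<omega> in M. \<forall>t\<ge>0. X t \<omega> = N t \<omega> + A t \<omega>"
    "AE \<omega> in M. cadlag (\<lambda>t. N t \<omega>) \<and> N 0 \<omega> = 0"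
    "AE \<omega> in M. continuous_on {0..} (\<lambda>t. A t \<omega>) \<and> mono_on {0..} (\<lambda>t. A t \<omega>) \<and> A 0 \<omega> = 0"
    "AE \<omega> in M. AE t in stieltjes (\<lambda>t. A t \<omega>). t \<ge> 0 \<longrightarrow> X t \<omega> = 0"
    "AE \<omega> in M. \<forall>t>0. X t \<omega> - Lim (at_left t) (\<lambda>s. X s \<omega>) \<le> 0"
    using class_Sigma only_negative_jumps
    unfolding class_Sigma_def only_negative_jumps_def by blast+
  then show ?thesis
    using A_top
  proof eventually_elim
    case (elim \<omega>)
    let ?x = "\<lambda>t. X t \<omega>" and ?a = "\<lambda>t. A t \<omega>" and ?n = "\<lambda>t. N t \<omega>"
    have n_right: "(?n \<longlongrightarrow> ?n t) (at_right t)" if "0 \<le> t" for t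
      using elim(3) that by (simp add: cadlag_def continuous_within)
    have x_cong: "(?x \<longlongrightarrow> l) G" if "((\<lambda>t. ?n t + ?a t) \<longlongrightarrow> l) G" "eventually (\<lambda>t. 0 \<le> t) G" for G l
    proof -
      have "eventually (\<lambda>t. ?x t = ?n t + ?a t) G"
        using that(2) by eventually_elim (use elim(2) in simp)
      with that(1) show ?thesis by (simp add: tendsto_cong)
    qed
    note a_tendsto = continuous_on_atLeast_tendsto[of 0 ?a]
    have "sigma_path ?x ?a"
    proof
      show "0 \<le> ?x t" if "0 \<le> t" for t using elim that by simp
      show "?x 0 = 0" "?a 0 = 0" using elim by auto
      show "(?x \<longlongrightarrow> ?x t) (at_right t)" if "0 \<le> t" for t
      proof (rule x_cong)
        show "((\<lambda>t. ?n t + ?a t) \<longlongrightarrow> ?x t) (at_right t)"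
          using elim that by (auto intro!: tendsto_intros n_right a_tendsto)
        show "eventually (\<lambda>s. 0 \<le> s) (at_right t)"
          using that by (auto simp: eventually_at_filter)
      qed
      show "\<exists>l. (?x \<longlongrightarrow> l) (at_left t) \<and> ?x t \<le> l" if t: "0 < t" for t
      proof -
        obtain l where l: "(?n \<longlongrightarrow> l) (at_left t)"
          using elim(3) t by (auto simp: cadlag_def)
        have "(?x \<longlongrightarrow> l + ?a t) (at_left t)"
        proof (rule x_cong)
          show "((\<lambda>t. ?n t + ?a t) \<longlongrightarrow> l + ?a t) (at_left t)"
            using elim t by (auto intro!: tendsto_intros l a_tendsto)
          show "eventually (\<lambda>s. 0 \<le> s) (at_left t)"
            using t unfolding eventually_at_left_field by (intro exI[of _ 0]) auto
        qed
        moreover from this have "Lim (at_left t) ?x = l + ?a t"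
          by (intro tendsto_Lim) auto
        ultimately show ?thesis
          using elim(6) t by (intro exI[of _ "l + ?a t"]) (auto dest!: spec[of _ t])
      qed
      show "continuous_on {0..} ?a" "filterlim ?a at_top at_top"
        using elim by auto
      show "?a s \<le> ?a t" if "0 \<le> s" "s \<le> t" for s t
        using elim that by (auto simp: mono_on_def)
      show "?a p = ?a q" if "0 \<le> p" "p < q" "\<And>t. p < t \<Longrightarrow> t < q \<Longrightarrow> ?x t \<noteq> 0" for p q
        by (rule stieltjes_null_flat[of ?a ?x]) (use elim that in auto)
    qed
    with elim n_right show ?case by auto
  qed
qed

lemma optional_time_level:
  assumes "0 \<le> b"
  shows "optional_time (debut (\<lambda>t \<omega>. b < A t \<omega>))"
proof (rule optional_time_debut)
  fix t :: real assume "0 \<le> t"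
  then have "A t -` {b<..} \<inter> space (F (ennreal t)) \<in> sets (F (ennreal t))"
    by (intro measurable_sets[OF adapted_A]) auto
  then show "{\<omega> \<in> space M. b < A t \<omega>} \<in> sets (F (ennreal t))"
    by (simp add: space_F vimage_def Int_def conj_commute)
next
  show "AE \<omega> in M. (\<exists>t\<ge>0. b < A t \<omega>) \<and> (\<forall>t\<ge>0. b < A t \<omega> \<longrightarrow> eventually (\<lambda>s. b < A s \<omega>) (at_right t))"
    using AE_path
  proof eventually_elim
    case (elim \<omega>)
    then interpret sigma_path "\<lambda>t. X t \<omega>" "\<lambda>t. A t \<omega>" by simp
    show ?case
      using level_nonempty[of b] order_tendstoD(1)[OF a_right] by blast
  qed
qed

lemma borel_measurable_A_at:
  assumes "\<sigma> \<in> borel_measurable M" "\<And>\<omega>. 0 \<le> \<sigma> \<omega>"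
  shows "(\<lambda>\<omega>. A (\<sigma> \<omega>) \<omega>) \<in> borel_measurable M"
proof (rule borel_measurable_eval(1)[OF _ _ assms])
  show "AE \<omega> in M. \<forall>t\<ge>0. continuous (at_right t) (\<lambda>s. A s \<omega>)"
    using AE_path by eventually_elim (metis continuous_within sigma_path.a_right)
qed (rule measurable_F_M[OF adapted_A])

lemma borel_measurable_X_at:
  assumes "\<sigma> \<in> borel_measurable M" "\<And>\<omega>. 0 \<le> \<sigma> \<omega>"
  shows "(\<lambda>\<omega>. X (\<sigma> \<omega>) \<omega>) \<in> borel_measurable M"
proof (rule borel_measurable_eval(1)[OF _ _ assms])
  show "AE \<omega> in M. \<forall>t\<ge>0. continuous (at_right t) (\<lambda>s. X s \<omega>)"
    using AE_path by eventually_elim (metis continuous_within sigma_path.x_right)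
qed (rule measurable_F_M[OF adapted_X])

text \<open>
  For \<open>h\<close> the indicator of \<open>(a,\<infinity>)\<close> this is optional stopping of \<open>N\<close> at \<open>\<sigma>\<close> and at \<open>min \<sigma> \<tau>\<close>, where \<open>\<tau>\<close> is
  the inverse of \<open>A\<close> at \<open>a\<close>: there \<open>X\<close> vanishes, so \<open>N = - a\<close>.
\<close>
lemma stopped_level_identity:
  assumes T: "stopping_time F T" and mart: "martingale M F (\<lambda>t \<omega>. stopped N T t \<omega> - N 0 \<omega>)"
    and S: "optional_time S" "\<And>\<omega>. S \<omega> \<le> m" and u: "AE \<omega> in M. A (S \<omega>) \<omega> \<le> u"
    and h: "h \<in> borel_measurable borel"
  defines "\<sigma> \<equiv> \<lambda>\<omega>. enn2real (min (ennreal (S \<omega>)) (T \<omega>))"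
  shows "\<sigma> \<in> borel_measurable M"
    and "(\<integral>\<^sup>+\<omega>. h (A (\<sigma> \<omega>) \<omega>) * ennreal (X (\<sigma> \<omega>) \<omega>) \<partial>M) =
      (\<integral>\<^sup>+\<omega>. (\<integral>\<^sup>+x\<in>{0..A (\<sigma> \<omega>) \<omega>}. h x \<partial>lborel) \<partial>M)"
proof -
  have [measurable]: "T \<in> borel_measurable M"
    by (rule measurable_stopping_time[OF T]) (auto simp: space_F sets_F_subset)
  have [measurable]: "S \<in> borel_measurable M"
    using S(1) by (rule optional_time_measurable)
  show \<sigma>_meas: "\<sigma> \<in> borel_measurable M"
    unfolding \<sigma>_def by measurable
  have S0: "0 \<le> S \<omega>" for \<omega>
    using S(1) by (rule optional_time_nonneg)
  have \<sigma>0: "0 \<le> \<sigma> \<omega>" for \<omega> by (simp add: \<sigma>_def)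
  have \<sigma>_le: "\<sigma> \<omega> \<le> S \<omega>" for \<omega>
    using S0[of \<omega>] by (simp add: \<sigma>_def enn2real_min_ennreal)
  \<comment> \<open>Evaluating the process stopped at \<open>T\<close> at time
    \<open>min S r\<close> reads \<open>N\<close> at \<open>min \<sigma> r\<close>; this turns
    optional stopping for \<open>Y\<close> into a statement about \<open>N\<close>.\<close>
  have \<sigma>_min: "enn2real (min (ennreal (min (S \<omega>) r)) (T \<omega>)) = min (\<sigma> \<omega>) r" if "0 \<le> r" for \<omega> r
    using that S0[of \<omega>] by (simp add: \<sigma>_def enn2real_min_ennreal) (simp add: ac_simps)
  note [measurable] = borel_measurable_A_at[OF \<sigma>_meas \<sigma>0] borel_measurable_X_at[OF \<sigma>_meas \<sigma>0]
  define Y where "Y t \<omega> = stopped N T t \<omega> - N 0 \<omega>" for t \<omega>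
  have Y_rc: "AE \<omega> in M. \<forall>t\<ge>0. continuous (at_right t) (\<lambda>s. Y s \<omega>)"
    using AE_path unfolding Y_def stopped_def
    by eventually_elim (auto intro!: continuous_intros continuous_at_right_stopped)
  have "martingale M F Y" using mart by (simp add: Y_def[abs_def])
  note stopping = optional_stopping[OF this Y_rc]
  have "Y 0 \<omega> = 0" for \<omega> by (simp add: Y_def stopped_def)
  then have Y: "integrable M (\<lambda>\<omega>. Y (R \<omega>) \<omega>)" "(\<integral>\<omega>. Y (R \<omega>) \<omega> \<partial>M) = 0"
    if "optional_time R" "\<And>\<omega>. R \<omega> \<le> m" for R
    using stopping[OF that] by simp_all
  have A_bounds: "AE \<omega> in M. 0 \<le> A (\<sigma> \<omega>) \<omega> \<and> A (\<sigma> \<omega>) \<omega> \<le> u"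
    using AE_path u
  proof eventually_elim
    case (elim \<omega>)
    then interpret sigma_path "\<lambda>t. X t \<omega>" "\<lambda>t. A t \<omega>" by simp
    show ?case
      using a_nonneg[OF \<sigma>0[of \<omega>]] a_mono[OF \<sigma>0[of \<omega>] \<sigma>_le[of \<omega>]] elim by linarith
  qed
  have A_int: "integrable M (\<lambda>\<omega>. A (\<sigma> \<omega>) \<omega>)"
    by (rule integrable_const_bound[where B = u]) (use A_bounds in auto)
  have X_nonneg: "AE \<omega> in M. 0 \<le> X (\<sigma> \<omega>) \<omega>"
    using AE_path by eventually_elim (auto intro: sigma_path.x_nonneg \<sigma>0)
  have Y_S: "AE \<omega> in M. Y (S \<omega>) \<omega> = X (\<sigma> \<omega>) \<omega> - A (\<sigma> \<omega>) \<omega>"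
    using AE_path
  proof eventually_elim
    case (elim \<omega>)
    then have "X (\<sigma> \<omega>) \<omega> = N (\<sigma> \<omega>) \<omega> + A (\<sigma> \<omega>) \<omega>" "N 0 \<omega> = 0"
      using \<sigma>0[of \<omega>] by blast+
    then show ?case by (simp add: Y_def stopped_def \<sigma>_def)
  qed
  \<comment> \<open>With \<open>A\<close> bounded at \<sigma>, integrability of the stopped
    martingale passes to \<open>X\<close>, and the mean of their difference may later be
    split.\<close>
  have X_int: "integrable M (\<lambda>\<omega>. X (\<sigma> \<omega>) \<omega>)"
  proof (rule integrable_cong_AE_imp)
    show "integrable M (\<lambda>\<omega>. Y (S \<omega>) \<omega> + A (\<sigma> \<omega>) \<omega>)"
      using Y(1)[OF S] A_int by (rule Bochner_Integration.integrable_add)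
    show "AE \<omega> in M. Y (S \<omega>) \<omega> + A (\<sigma> \<omega>) \<omega> = X (\<sigma> \<omega>) \<omega>"
      using Y_S by eventually_elim simp
  qed measurable
  have level: "(\<integral>\<^sup>+\<omega>. ennreal (X (\<sigma> \<omega>) \<omega>) * indicator {a<..} (A (\<sigma> \<omega>) \<omega>) \<partial>M) =
      (\<integral>\<^sup>+\<omega>. ennreal (A (\<sigma> \<omega>) \<omega> - max 0 a) \<partial>M)" for a
  proof -
    let ?I = "\<lambda>\<omega>. indicator {a<..} (A (\<sigma> \<omega>) \<omega>) :: real"
    have int_I: "integrable M (\<lambda>\<omega>. ?I \<omega> * g \<omega>)" if "integrable M g" for g :: "'a \<Rightarrow> real"
      by (rule Bochner_Integration.integrable_bound[OF that]) (use that in \<open>auto simp: indicator_def\<close>)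
    \<comment> \<open>For \<open>a < 0\<close> the indicator is 1 and \<open>R\<close> is the
      martingale at \<open>S\<close>. Otherwise \<open>R\<close> is its increment from
      \<open>min S \<tau>\<close> to \<open>S\<close>, which vanishes unless \<open>A\<close> has
      passed \<open>a\<close> by time \<sigma>.\<close>
    have "\<exists>R. integrable M R \<and> (\<integral>\<omega>. R \<omega> \<partial>M) = 0 \<and>
      (AE \<omega> in M. ?I \<omega> * (X (\<sigma> \<omega>) \<omega> - (A (\<sigma> \<omega>) \<omega> - max 0 a)) = R \<omega>)"
    proof (cases "a < 0")
      case True
      have "AE \<omega> in M. ?I \<omega> * (X (\<sigma> \<omega>) \<omega> - (A (\<sigma> \<omega>) \<omega> - max 0 a)) = Y (S \<omega>) \<omega>"
        using Y_S A_bounds by eventually_elim (use True in auto)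
      then show ?thesis using Y[OF S] by blast
    next
      case False
      define \<tau> where "\<tau> = debut (\<lambda>t \<omega>. a < A t \<omega>)"
      have \<tau>: "optional_time \<tau>"
        unfolding \<tau>_def using False by (intro optional_time_level) auto
      have S\<tau>: "optional_time (\<lambda>\<omega>. min (S \<omega>) (\<tau> \<omega>))" "\<And>\<omega>. min (S \<omega>) (\<tau> \<omega>) \<le> m"
        using optional_time_min[OF S(1) \<tau>] S(2) by (auto simp: min_le_iff_disj)
      have "AE \<omega> in M. ?I \<omega> * (X (\<sigma> \<omega>) \<omega> - (A (\<sigma> \<omega>) \<omega> - max 0 a)) =
          Y (S \<omega>) \<omega> - Y (min (S \<omega>) (\<tau> \<omega>)) \<omega>"
        using AE_path
      proof eventually_elim
        case (elim \<omega>)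
        then interpret sigma_path "\<lambda>t. X t \<omega>" "\<lambda>t. A t \<omega>" by simp
        have "0 \<le> a" using False by simp
        note inv = inverse_level[OF this]
        have \<tau>_eq: "\<tau> \<omega> = Inf {t. 0 \<le> t \<and> a < A t \<omega>}"
          using inv(1) by (simp add: \<tau>_def debut_def)
        have X_N: "X t \<omega> = N t \<omega> + A t \<omega>" if "0 \<le> t" for t
          using elim that by simp
        have Y_diff: "Y (S \<omega>) \<omega> - Y (min (S \<omega>) (\<tau> \<omega>)) \<omega> = N (\<sigma> \<omega>) \<omega> - N (min (\<sigma> \<omega>) (\<tau> \<omega>)) \<omega>"
          using \<sigma>_min[of "\<tau> \<omega>" \<omega>] inv(1) by (simp add: Y_def stopped_def \<tau>_eq \<sigma>_def)
        show ?case
        proof (cases "a < A (\<sigma> \<omega>) \<omega>")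
          case True
          then have "min (\<sigma> \<omega>) (\<tau> \<omega>) = \<tau> \<omega>"
            using inv(4)[OF \<sigma>0] by (simp add: \<tau>_eq)
          moreover have "N (\<tau> \<omega>) \<omega> = - a"
            using X_N[of "\<tau> \<omega>"] inv(1-3) by (simp add: \<tau>_eq)
          ultimately show ?thesis
            using True X_N[OF \<sigma>0] \<open>0 \<le> a\<close> by (simp add: Y_diff)
        next
          case False
          then have "min (\<sigma> \<omega>) (\<tau> \<omega>) = \<sigma> \<omega>"
            using inv(4)[OF \<sigma>0] by (simp add: \<tau>_eq)
          then show ?thesis using False by (simp add: Y_diff)
        qed
      qed
      then show ?thesis
        using Y[OF S] Y[OF S\<tau>]
        by (intro exI[of _ "\<lambda>\<omega>. Y (S \<omega>) \<omega> - Y (min (S \<omega>) (\<tau> \<omega>)) \<omega>"]) auto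
    qed
    then obtain R where R: "integrable M R" "(\<integral>\<omega>. R \<omega> \<partial>M) = 0"
      "AE \<omega> in M. ?I \<omega> * (X (\<sigma> \<omega>) \<omega> - (A (\<sigma> \<omega>) \<omega> - max 0 a)) = R \<omega>" by blast
    have A_max: "integrable M (\<lambda>\<omega>. A (\<sigma> \<omega>) \<omega> - max 0 a)"
      using A_int by auto
    have "(\<integral>\<omega>. ?I \<omega> * X (\<sigma> \<omega>) \<omega> \<partial>M) - (\<integral>\<omega>. ?I \<omega> * (A (\<sigma> \<omega>) \<omega> - max 0 a) \<partial>M) =
        (\<integral>\<omega>. ?I \<omega> * X (\<sigma> \<omega>) \<omega> - ?I \<omega> * (A (\<sigma> \<omega>) \<omega> - max 0 a) \<partial>M)"
      by (rule Bochner_Integration.integral_diff[OF int_I[OF X_int] int_I[OF A_max], symmetric])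
    also have "\<dots> = (\<integral>\<omega>. R \<omega> \<partial>M)"
    proof (rule integral_cong_AE)
      show "AE \<omega> in M. ?I \<omega> * X (\<sigma> \<omega>) \<omega> - ?I \<omega> * (A (\<sigma> \<omega>) \<omega> - max 0 a) = R \<omega>"
        using R(3) by eventually_elim (simp add: algebra_simps)
    qed (use R(1) in measurable)
    finally have eq: "(\<integral>\<omega>. ?I \<omega> * X (\<sigma> \<omega>) \<omega> \<partial>M) = (\<integral>\<omega>. ?I \<omega> * (A (\<sigma> \<omega>) \<omega> - max 0 a) \<partial>M)"
      using R(2) by simp
    have "(\<integral>\<^sup>+\<omega>. ennreal (X (\<sigma> \<omega>) \<omega>) * indicator {a<..} (A (\<sigma> \<omega>) \<omega>) \<partial>M) = (\<integral>\<^sup>+\<omega>. ennreal (?I \<omega> * X (\<sigma> \<omega>) \<omega>) \<partial>M)"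
      by (intro nn_integral_cong) (simp add: indicator_def)
    also have "\<dots> = ennreal (\<integral>\<omega>. ?I \<omega> * X (\<sigma> \<omega>) \<omega> \<partial>M)"
      using X_nonneg by (intro nn_integral_eq_integral int_I X_int) (auto elim!: eventually_mono)
    also have "\<dots> = (\<integral>\<^sup>+\<omega>. ennreal (?I \<omega> * (A (\<sigma> \<omega>) \<omega> - max 0 a)) \<partial>M)"
      unfolding eq using A_bounds
      by (intro nn_integral_eq_integral[symmetric] int_I A_max) (auto elim!: eventually_mono simp: indicator_def)
    also have "\<dots> = (\<integral>\<^sup>+\<omega>. ennreal (A (\<sigma> \<omega>) \<omega> - max 0 a) \<partial>M)"
    proof (rule nn_integral_cong_AE)
      \<comment> \<open>Where the indicator is 0, the difference is nonpositive, so
        \<open>ennreal\<close> already sends it to 0.\<close>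
      show "AE \<omega> in M. ennreal (?I \<omega> * (A (\<sigma> \<omega>) \<omega> - max 0 a)) = ennreal (A (\<sigma> \<omega>) \<omega> - max 0 a)"
        using A_bounds by eventually_elim (auto simp: indicator_def ennreal_neg)
    qed
    finally show ?thesis .
  qed
  have "AE \<omega> in M. 0 \<le> A (\<sigma> \<omega>) \<omega>"
    using A_bounds by eventually_elim simp
  from nn_integral_level_identity[OF borel_measurable_X_at[OF \<sigma>_meas \<sigma>0] A_int h this level]
  show "(\<integral>\<^sup>+\<omega>. h (A (\<sigma> \<omega>) \<omega>) * ennreal (X (\<sigma> \<omega>) \<omega>) \<partial>M) =
      (\<integral>\<^sup>+\<omega>. (\<integral>\<^sup>+x\<in>{0..A (\<sigma> \<omega>) \<omega>}. h x \<partial>lborel) \<partial>M)" .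
qed

section \<open>First passage probabilities\<close>

text \<open>
  No projection theorem is needed: a passage persists for a while, since \<open>A\<close> is constant on
  excursions, and is therefore seen at a rational time.
\<close>
lemma passage_event_measurable:
  assumes [measurable]: "\<phi> \<in> borel_measurable borel" and \<phi>: "\<And>y. 0 \<le> \<phi> y"
  shows "{\<omega> \<in> space M. \<exists>t\<ge>0. A t \<omega> \<le> u \<and> \<phi> (A t \<omega>) < X t \<omega>} \<in> sets M"
proof (rule in_sets_AE)
  let ?B = "\<Union>q\<in>{q\<in>\<rat>. 0 \<le> q}. {\<omega> \<in> space M. A q \<omega> \<le> u \<and> \<phi> (A q \<omega>) < X q \<omega>}"
  show "?B \<in> sets M"
  proof (rule sets.countable_UN'')
    show "countable {q\<in>\<rat>. 0 \<le> q}"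
      by (rule countable_subset[OF _ countable_rat]) auto
    fix q :: real assume "q \<in> {q\<in>\<rat>. 0 \<le> q}"
    then have [measurable]: "A q \<in> borel_measurable M" "X q \<in> borel_measurable M"
      by (auto intro: measurable_F_M adapted_A adapted_X)
    show "{\<omega> \<in> space M. A q \<omega> \<le> u \<and> \<phi> (A q \<omega>) < X q \<omega>} \<in> sets M"
      by measurable
  qed
  show "AE \<omega> in M. \<omega> \<in> ?B \<longleftrightarrow> \<omega> \<in> {\<omega> \<in> space M. \<exists>t\<ge>0. A t \<omega> \<le> u \<and> \<phi> (A t \<omega>) < X t \<omega>}"
    using AE_path
  proof eventually_elim
    case (elim \<omega>)
    then interpret sigma_path "\<lambda>t. X t \<omega>" "\<lambda>t. A t \<omega>" by simp
    have "\<exists>q\<in>\<rat>. 0 \<le> q \<and> A q \<omega> \<le> u \<and> \<phi> (A q \<omega>) < X q \<omega>"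
      if t: "0 \<le> t" "A t \<omega> \<le> u" "\<phi> (A t \<omega>) < X t \<omega>" for t
    proof -
      obtain b where b: "t < b" "\<And>s. t < s \<Longrightarrow> s < b \<Longrightarrow> A s \<omega> = A t \<omega> \<and> \<phi> (A s \<omega>) < X s \<omega>"
        using exceed_right[of t \<phi>] t \<phi> unfolding eventually_at_right_field by auto
      obtain q where "q \<in> \<rat>" "t < q" "q < b"
        using Rats_dense_in_real[OF b(1)] by auto
      then show ?thesis
        using b(2)[of q] t by (intro bexI[of _ q]) auto
    qed
    then show ?case by auto
  qed
qed auto

text \<open>
  The level identity is applied to \<open>h = f exp G\<close> with \<open>f = 1 / \<phi>\<close> on \<open>[0,u]\<close> and \<open>G\<close> its primitive. At the
  passage time \<open>S\<close> one has \<open>f(A) X = 1\<close> if \<open>E\<close> occurs, and \<open>A = u\<close>, \<open>X = 0\<close> otherwise.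
\<close>
lemma prob_passage_bounded_below:
  assumes \<phi>_meas [measurable]: "\<phi> \<in> borel_measurable borel" and \<phi>: "\<And>y. \<delta> \<le> \<phi> y" "0 < \<delta>" and u: "0 \<le> u"
  shows "prob {\<omega> \<in> space M. \<exists>t\<ge>0. A t \<omega> \<le> u \<and> \<phi> (A t \<omega>) < X t \<omega>} =
    1 - exp_minus (\<integral>\<^sup>+x\<in>{0..u}. (1 / ennreal (\<phi> x)) \<partial>lborel)"
proof -
  define E where "E = {\<omega> \<in> space M. \<exists>t\<ge>0. A t \<omega> \<le> u \<and> \<phi> (A t \<omega>) < X t \<omega>}"
  have \<phi>_pos: "0 < \<phi> y" for y
    using \<phi>(1)[of y] \<phi>(2) by simp
  have [measurable]: "E \<in> sets M"
    unfolding E_def by (intro passage_event_measurable \<phi>_meas less_imp_le \<phi>_pos)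
  define f where "f y = indicator {0..u} y / \<phi> y" for y
  have [measurable]: "f \<in> borel_measurable borel"
    unfolding f_def by measurable
  have f: "0 \<le> f y" "f y \<le> 1 / \<delta>" for y
    using \<phi>_pos[of y] \<phi>(1)[of y] \<phi>(2) by (auto simp: f_def indicator_def frac_le)
  define G where "G y = integral {0..y} f" for y
  have "mono G"
    unfolding G_def using f by (intro mono_primitive) auto
  then have [measurable]: "G \<in> borel_measurable borel"
    by (rule borel_measurable_mono)
  have G0: "G 0 = 0" by (simp add: G_def)
  have G_int: "(f has_integral G u) {0..u}"
    unfolding G_def using f
    by (intro integrable_integral borel_bounded_integrable_on_Icc[where B = "1 / \<delta>"]) auto
  define h where "h y = f y * exp (G y)" for y
  have [measurable]: "h \<in> borel_measurable borel"
    unfolding h_def by measurable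
  have h_nonneg: "0 \<le> h y" for y by (simp add: h_def f)
  have h_int: "(\<integral>\<^sup>+x\<in>{0..a}. ennreal (h x) \<partial>lborel) = ennreal (exp (G a) - 1)" if "0 \<le> a" for a
    unfolding h_def G_def using f that by (intro nn_integral_exp_primitive) auto
  obtain T where T: "localizing_sequence M F T"
    "\<And>n. martingale M F (\<lambda>t \<omega>. stopped N (T n) t \<omega> - N 0 \<omega>)"
    using class_Sigma unfolding class_Sigma_def local_martingale_def by blast
  define S where "S = debut (\<lambda>t \<omega>. u < A t \<omega> \<or> \<phi> (A t \<omega>) < X t \<omega>)"
  have S_opt: "optional_time S"
    unfolding S_def
  proof (rule optional_time_debut)
    fix t :: real assume "0 \<le> t"
    note [measurable] = adapted_A[OF this] adapted_X[OF this]
    have "{\<omega> \<in> space (F (ennreal t)). u < A t \<omega> \<or> \<phi> (A t \<omega>) < X t \<omega>} \<in> sets (F (ennreal t))"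
      by measurable
    then show "{\<omega> \<in> space M. u < A t \<omega> \<or> \<phi> (A t \<omega>) < X t \<omega>} \<in> sets (F (ennreal t))"
      by (simp add: space_F)
  next
    show "AE \<omega> in M. (\<exists>t\<ge>0. u < A t \<omega> \<or> \<phi> (A t \<omega>) < X t \<omega>) \<and>
        (\<forall>t\<ge>0. u < A t \<omega> \<or> \<phi> (A t \<omega>) < X t \<omega> \<longrightarrow>
          eventually (\<lambda>s. u < A s \<omega> \<or> \<phi> (A s \<omega>) < X s \<omega>) (at_right t))"
      using AE_path
    proof eventually_elim
      case (elim \<omega>)
      then interpret sigma_path "\<lambda>t. X t \<omega>" "\<lambda>t. A t \<omega>" by simp
      have "eventually (\<lambda>s. u < A s \<omega> \<or> \<phi> (A s \<omega>) < X s \<omega>) (at_right t)"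
        if "0 \<le> t" "u < A t \<omega> \<or> \<phi> (A t \<omega>) < X t \<omega>" for t
        using that(2)
      proof
        assume "u < A t \<omega>"
        from order_tendstoD(1)[OF a_right[OF that(1)] this] show ?thesis
          by (rule eventually_mono) simp
      next
        assume "\<phi> (A t \<omega>) < X t \<omega>"
        from exceed_right[of t \<phi>, OF that(1) this less_imp_le[OF \<phi>_pos]] show ?thesis
          by (rule eventually_mono) blast
      qed
      then show ?case using level_nonempty[of u] by blast
    qed
  qed
  have S0: "0 \<le> S \<omega>" for \<omega>
    using S_opt by (rule optional_time_nonneg)
  have S_meas: "S \<in> borel_measurable M"
    using S_opt by (rule optional_time_measurable)
  have S_cases: "AE \<omega> in M.
      (\<omega> \<in> E \<longrightarrow> X (S \<omega>) \<omega> = \<phi> (A (S \<omega>) \<omega>)) \<and> (\<omega> \<notin> E \<longrightarrow> X (S \<omega>) \<omega> = 0 \<and> A (S \<omega>) \<omega> = u) \<and>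
      (\<forall>t. 0 \<le> t \<longrightarrow> t \<le> S \<omega> \<longrightarrow> 0 \<le> A t \<omega> \<and> A t \<omega> \<le> u \<and> 0 \<le> X t \<omega> \<and> X t \<omega> \<le> \<phi> (A t \<omega>))"
    using AE_path AE_space
  proof eventually_elim
    case (elim \<omega>)
    then interpret sigma_path "\<lambda>t. X t \<omega>" "\<lambda>t. A t \<omega>" by simp
    note cases = passage_cases[of \<delta> \<phi> u, OF \<phi> u]
    have "S \<omega> = Inf {t. 0 \<le> t \<and> (u < A t \<omega> \<or> \<phi> (A t \<omega>) < X t \<omega>)}"
      using cases(1) by (simp add: S_def debut_def)
    then show ?case
      using cases(2-4) elim(2) x_nonneg a_nonneg unfolding E_def by auto
  qed
  \<comment> \<open>The cap \<open>n\<close> makes the time bounded and \<open>T n\<close> makes the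
    stopped \<open>N\<close> a martingale. As \<open>S\<close> is finite, both restrictions
    eventually cease to act on almost every path.\<close>
  define \<sigma> where "\<sigma> n \<omega> = enn2real (min (ennreal (min (S \<omega>) (real n))) (T n \<omega>))" for n \<omega>
  have \<sigma>0: "0 \<le> \<sigma> n \<omega>" and \<sigma>_le: "\<sigma> n \<omega> \<le> S \<omega>" for n \<omega>
    using S0[of \<omega>] by (auto simp: \<sigma>_def enn2real_min_ennreal)
  have \<sigma>_bounds: "AE \<omega> in M. 0 \<le> A (\<sigma> n \<omega>) \<omega> \<and> A (\<sigma> n \<omega>) \<omega> \<le> u \<and> 0 \<le> X (\<sigma> n \<omega>) \<omega> \<and>
      X (\<sigma> n \<omega>) \<omega> \<le> \<phi> (A (\<sigma> n \<omega>) \<omega>)" for n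
    using S_cases by eventually_elim (use \<sigma>0 \<sigma>_le in blast)
  have \<sigma>_eventually: "AE \<omega> in M. eventually (\<lambda>n. \<sigma> n \<omega> = S \<omega>) sequentially"
  proof -
    have "AE \<omega> in M. (\<lambda>n. T n \<omega>) \<longlonglongrightarrow> \<infinity>"
      using T(1) unfolding localizing_sequence_def by (auto elim: eventually_mono)
    then show ?thesis
    proof eventually_elim
      case (elim \<omega>)
      then have "eventually (\<lambda>n. ennreal (S \<omega>) < T n \<omega>) sequentially"
        by (rule order_tendstoD) simp
      moreover have "eventually (\<lambda>n. S \<omega> \<le> real n) sequentially"
        by (metis eventually_at_top_linorderI nle_le order_trans of_nat_le_iff real_nat_ceiling_ge)
      ultimately show ?case
        by eventually_elim (use S0[of \<omega>] in \<open>simp add: \<sigma>_def min_absorb1 less_imp_le\<close>)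
    qed
  qed
  define L where "L n \<omega> = h (A (\<sigma> n \<omega>) \<omega>) * X (\<sigma> n \<omega>) \<omega>" for n \<omega>
  define R where "R n \<omega> = exp (G (A (\<sigma> n \<omega>) \<omega>)) - 1" for n \<omega>
  have S_min: "optional_time (\<lambda>\<omega>. min (S \<omega>) (real n))" "min (S \<omega>) (real n) \<le> real n" for n \<omega>
    by (rule optional_time_min[OF S_opt optional_time_const]) simp_all
  have S_min_u: "AE \<omega> in M. A (min (S \<omega>) (real n)) \<omega> \<le> u" for n
    using S_cases by eventually_elim (use S0 in simp)
  have stopping_T: "stopping_time F (T n)" for n
    using T(1) unfolding localizing_sequence_def by blast
  note level = stopped_level_identity[OF stopping_T T(2) S_min S_min_u]
  \<comment> \<open>This conclusion does not involve the test function, so zero is inserted for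
    it.\<close>
  have \<sigma>_meas: "\<sigma> n \<in> borel_measurable M" for n
    using level(1)[of "\<lambda>_. 0" n] by (simp add: \<sigma>_def[abs_def])
  note [measurable] = borel_measurable_A_at[OF \<sigma>_meas \<sigma>0] borel_measurable_X_at[OF \<sigma>_meas \<sigma>0]
    borel_measurable_A_at[OF S_meas S0] borel_measurable_X_at[OF S_meas S0]
  have L_meas [measurable]: "L n \<in> borel_measurable M" and R_meas [measurable]: "R n \<in> borel_measurable M" for n
    unfolding L_def R_def by measurable
  have G_bounds: "0 \<le> G a \<and> G a \<le> G u" if "0 \<le> a" "a \<le> u" for a
    using monoD[OF \<open>mono G\<close> that(1)] monoD[OF \<open>mono G\<close> that(2)] G0 by simp
  \<comment> \<open>\<open>X\<close> need not be bounded before \<open>S\<close>, as \<phi> may be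
    unbounded; but \<open>X \<le> \<phi>(A)\<close> there, so \<open>f(A) X \<le> 1\<close>. This
    supplies the dominating constant for the limit in \<open>n\<close>.\<close>
  have L_bounds: "AE \<omega> in M. 0 \<le> L n \<omega> \<and> L n \<omega> \<le> exp (G u)" for n
    using \<sigma>_bounds[of n]
  proof eventually_elim
    case (elim \<omega>)
    let ?a = "A (\<sigma> n \<omega>) \<omega>" and ?x = "X (\<sigma> n \<omega>) \<omega>"
    have "f ?a * ?x \<le> 1"
      using elim \<phi>_pos[of ?a] by (simp add: f_def divide_le_eq)
    then have "(f ?a * ?x) * exp (G ?a) \<le> 1 * exp (G u)"
      using G_bounds[of ?a] elim f by (intro mult_mono) auto
    then show ?case
      using elim f by (auto simp: L_def h_def mult_ac)
  qed
  have R_bounds: "AE \<omega> in M. 0 \<le> R n \<omega> \<and> R n \<omega> \<le> exp (G u)" for n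
    using \<sigma>_bounds[of n]
  proof eventually_elim
    case (elim \<omega>)
    then show ?case
      using G_bounds[of "A (\<sigma> n \<omega>) \<omega>"] by (auto simp: R_def intro: order_trans[of _ "exp (G (A (\<sigma> n \<omega>) \<omega>))"])
  qed
  have L_R: "(\<integral>\<omega>. L n \<omega> \<partial>M) = (\<integral>\<omega>. R n \<omega> \<partial>M)" for n
  proof -
    have "(\<integral>\<^sup>+\<omega>. ennreal (L n \<omega>) \<partial>M) = (\<integral>\<^sup>+\<omega>. ennreal (h (A (\<sigma> n \<omega>) \<omega>)) * ennreal (X (\<sigma> n \<omega>) \<omega>) \<partial>M)"
      by (simp add: L_def ennreal_mult' h_nonneg)
    also have "\<dots> = (\<integral>\<^sup>+\<omega>. (\<integral>\<^sup>+x\<in>{0..A (\<sigma> n \<omega>) \<omega>}. ennreal (h x) \<partial>lborel) \<partial>M)"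
      using level(2)[of "\<lambda>x. ennreal (h x)" n] by (simp add: \<sigma>_def)
    also have "\<dots> = (\<integral>\<^sup>+\<omega>. ennreal (R n \<omega>) \<partial>M)"
    proof (rule nn_integral_cong_AE)
      show "AE \<omega> in M. (\<integral>\<^sup>+x\<in>{0..A (\<sigma> n \<omega>) \<omega>}. ennreal (h x) \<partial>lborel) = ennreal (R n \<omega>)"
        using \<sigma>_bounds[of n] by eventually_elim (simp add: h_int R_def)
    qed
    finally have "(\<integral>\<^sup>+\<omega>. ennreal (L n \<omega>) \<partial>M) = (\<integral>\<^sup>+\<omega>. ennreal (R n \<omega>) \<partial>M)" .
    moreover have "AE \<omega> in M. 0 \<le> L n \<omega>" "AE \<omega> in M. 0 \<le> R n \<omega>"
      using L_bounds[of n] R_bounds[of n] by (auto elim: eventually_mono)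
    ultimately show ?thesis
      by (simp add: integral_eq_nn_integral)
  qed
  let ?L = "\<lambda>\<omega>. h (A (S \<omega>) \<omega>) * X (S \<omega>) \<omega>" and ?R = "\<lambda>\<omega>. exp (G (A (S \<omega>) \<omega>)) - 1"
  have bound: "integrable M (\<lambda>_. exp (G u))" by simp
  have L_lim: "AE \<omega> in M. (\<lambda>n. L n \<omega>) \<longlonglongrightarrow> ?L \<omega>"
    using \<sigma>_eventually
    by eventually_elim (rule tendsto_eventually, erule eventually_mono, simp add: L_def)
  have L_norm: "AE \<omega> in M. norm (L n \<omega>) \<le> exp (G u)" for n
    using L_bounds[of n] by eventually_elim simp
  have R_lim: "AE \<omega> in M. (\<lambda>n. R n \<omega>) \<longlonglongrightarrow> ?R \<omega>"
    using \<sigma>_eventually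
    by eventually_elim (rule tendsto_eventually, erule eventually_mono, simp add: R_def)
  have R_norm: "AE \<omega> in M. norm (R n \<omega>) \<le> exp (G u)" for n
    using R_bounds[of n] by eventually_elim simp
  have L_int: "integrable M ?L"
    by (rule integrable_dominated_convergence[OF _ L_meas bound L_lim L_norm]) measurable
  have R_int: "integrable M ?R"
    by (rule integrable_dominated_convergence[OF _ R_meas bound R_lim R_norm]) measurable
  have "(\<lambda>n. \<integral>\<omega>. L n \<omega> \<partial>M) \<longlonglongrightarrow> (\<integral>\<omega>. ?L \<omega> \<partial>M)"
    by (rule integral_dominated_convergence[OF _ L_meas bound L_lim L_norm]) measurable
  moreover have "(\<lambda>n. \<integral>\<omega>. R n \<omega> \<partial>M) \<longlonglongrightarrow> (\<integral>\<omega>. ?R \<omega> \<partial>M)"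
    by (rule integral_dominated_convergence[OF _ R_meas bound R_lim R_norm]) measurable
  ultimately have "(\<integral>\<omega>. ?L \<omega> \<partial>M) = (\<integral>\<omega>. ?R \<omega> \<partial>M)"
    unfolding L_R by (rule LIMSEQ_unique)
  then have "(\<integral>\<omega>. ?L \<omega> - ?R \<omega> \<partial>M) = 0"
    using L_int R_int by simp
  \<comment> \<open>The difference is 1 on \<open>E\<close>, whatever the height of the passage, and
    \<open>1 - exp (G u)\<close> off \<open>E\<close>; both values are combined in one expression
    linear in the indicator.\<close>
  moreover have "(\<integral>\<omega>. ?L \<omega> - ?R \<omega> \<partial>M) = (\<integral>\<omega>. exp (G u) * indicator E \<omega> - (exp (G u) - 1) \<partial>M)"
  proof (rule integral_cong_AE)
    show "AE \<omega> in M. ?L \<omega> - ?R \<omega> = exp (G u) * indicator E \<omega> - (exp (G u) - 1)"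
      using S_cases
    proof eventually_elim
      case (elim \<omega>)
      show ?case
      proof (cases "\<omega> \<in> E")
        case True
        then have "f (A (S \<omega>) \<omega>) * X (S \<omega>) \<omega> = 1"
          using elim S0[of \<omega>] \<phi>_pos[of "A (S \<omega>) \<omega>"] by (simp add: f_def)
        then have "h (A (S \<omega>) \<omega>) * X (S \<omega>) \<omega> = exp (G (A (S \<omega>) \<omega>))"
          by (simp add: h_def mult.commute mult.left_commute)
        then show ?thesis using True by simp
      next
        case False
        then show ?thesis using elim by simp
      qed
    qed
  qed measurable
  moreover have "integrable M (indicator E :: 'a \<Rightarrow> real)"
    by (rule integrable_real_indicator) (auto simp: emeasure_eq_measure)
  ultimately have "exp (G u) * prob E = exp (G u) - 1"
    by (simp add: prob_space)
  then have "prob E = 1 - exp (- G u)"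
    by (simp add: exp_minus field_simps)
  moreover have "(\<integral>\<^sup>+x\<in>{0..u}. (1 / ennreal (\<phi> x)) \<partial>lborel) = ennreal (G u)"
  proof -
    have "(\<integral>\<^sup>+x\<in>{0..u}. (1 / ennreal (\<phi> x)) \<partial>lborel) = (\<integral>\<^sup>+x. ennreal (indicator {0..u} x * f x) \<partial>lborel)"
    proof (rule nn_integral_cong)
      fix x
      show "1 / ennreal (\<phi> x) * indicator {0..u} x = ennreal (indicator {0..u} x * f x)"
        using \<phi>_pos[of x] divide_ennreal[of 1 "\<phi> x"] by (simp add: f_def indicator_def)
    qed
    also have "\<dots> = ennreal (G u)"
      using G_int f by (intro nn_integral_has_integral_lebesgue) auto
    finally show ?thesis .
  qed
  ultimately show ?thesis
    using G_bounds[of u] u by (simp add: E_def exp_minus_def)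
qed

text \<open>Because the excess is strict and \<phi> is nonnegative, a value above \<phi> is also
  above \<open>max \<phi> (1/(n+1))\<close> for large \<open>n\<close>. Hence the passage events for
  the raised barriers increase exactly to the desired one, while the integrals increase to a
  possibly infinite limit.\<close>

lemma prob_passage:
  assumes \<phi>_meas [measurable]: "\<phi> \<in> borel_measurable borel" and \<phi>: "\<And>y. 0 \<le> \<phi> y" and u: "0 \<le> u"
  shows "prob {\<omega> \<in> space M. \<exists>t\<ge>0. A t \<omega> \<le> u \<and> \<phi> (A t \<omega>) < X t \<omega>} =
    1 - exp_minus (\<integral>\<^sup>+x\<in>{0..u}. (1 / ennreal (\<phi> x)) \<partial>lborel)"
proof -
  define \<psi> where "\<psi> n y = max (\<phi> y) (1 / real (Suc n))" for n y
  have \<psi>_meas [measurable]: "\<psi> n \<in> borel_measurable borel" for n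
    unfolding \<psi>_def by measurable
  have \<psi>_pos: "0 < \<psi> n y" for n y by (simp add: \<psi>_def less_max_iff_disj)
  have \<psi>_antimono: "\<psi> n y \<le> \<psi> m y" if "m \<le> n" for m n y
    unfolding \<psi>_def using that by (intro max.mono frac_le) auto
  define E where "E n = {\<omega> \<in> space M. \<exists>t\<ge>0. A t \<omega> \<le> u \<and> \<psi> n (A t \<omega>) < X t \<omega>}" for n
  let ?I = "\<lambda>n. \<integral>\<^sup>+x\<in>{0..u}. (1 / ennreal (\<psi> n x)) \<partial>lborel"
  have "(\<lambda>n. prob (E n)) \<longlonglongrightarrow> prob (\<Union>n. E n)"
  proof (rule finite_Lim_measure_incseq)
    show "range E \<subseteq> sets M"
      unfolding E_def using passage_event_measurable[OF \<psi>_meas less_imp_le[OF \<psi>_pos]] by blast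
    show "incseq E"
      unfolding incseq_def E_def using \<psi>_antimono by (blast intro: le_less_trans)
  qed
  moreover have "(\<Union>n. E n) = {\<omega> \<in> space M. \<exists>t\<ge>0. A t \<omega> \<le> u \<and> \<phi> (A t \<omega>) < X t \<omega>}"
  proof -
    have "(\<exists>n. \<psi> n y < x) \<longleftrightarrow> \<phi> y < x" for x y
    proof
      assume "\<phi> y < x"
      then obtain n where "1 / real (Suc n) < x"
        using \<phi>[of y] reals_Archimedean[of x] by (auto simp: inverse_eq_divide)
      then show "\<exists>n. \<psi> n y < x" using \<open>\<phi> y < x\<close> by (auto simp: \<psi>_def)
    qed (auto simp: \<psi>_def)
    then show ?thesis unfolding E_def by blast
  qed
  moreover have "prob (E n) = 1 - exp_minus (?I n)" for n
    unfolding E_def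
    by (rule prob_passage_bounded_below[OF \<psi>_meas _ _ u, of "1 / real (Suc n)"]) (auto simp: \<psi>_def)
  moreover have "(\<lambda>n. 1 - exp_minus (?I n)) \<longlonglongrightarrow> 1 - exp_minus (\<integral>\<^sup>+x\<in>{0..u}. (1 / ennreal (\<phi> x)) \<partial>lborel)"
  proof (intro tendsto_diff tendsto_const tendsto_exp_minus nn_integral_LIMSEQ)
    show "incseq (\<lambda>n x. 1 / ennreal (\<psi> n x) * indicator {0..u} x)"
    proof -
      have "1 / ennreal (\<psi> n y) = ennreal (1 / \<psi> n y)" for n y
        using divide_ennreal[of 1 "\<psi> n y"] \<psi>_pos[of n y] by simp
      then show ?thesis
        unfolding incseq_def le_fun_def
        by (auto intro!: mult_right_mono ennreal_leI frac_le \<psi>_antimono \<psi>_pos)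
    qed
    show "(\<lambda>x. 1 / ennreal (\<psi> n x) * indicator {0..u} x) \<in> borel_measurable lborel" for n
      by measurable
    fix x
    have "(\<lambda>n. 1 / real (Suc n)) \<longlonglongrightarrow> 0"
      by (rule LIMSEQ_Suc[OF lim_1_over_n])
    then have "(\<lambda>n. \<psi> n x) \<longlonglongrightarrow> max (\<phi> x) 0"
      unfolding \<psi>_def by (intro tendsto_intros)
    then have "(\<lambda>n. \<psi> n x) \<longlonglongrightarrow> \<phi> x" using \<phi>[of x] by simp
    then have "(\<lambda>n. ennreal (\<psi> n x)) \<longlonglongrightarrow> ennreal (\<phi> x)"
      by (rule tendsto_ennrealI)
    \<comment> \<open>Inversion on \<open>ennreal\<close> is continuous at 0 with value \<infinity>,
      which covers the zeros of \<phi> under the convention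
      \<open>1/0 = \<infinity>\<close>.\<close>
    then have "(\<lambda>n. inverse (ennreal (\<psi> n x))) \<longlonglongrightarrow> inverse (ennreal (\<phi> x))"
      by (rule continuous_on_tendsto_compose[OF continuous_on_inverse_ennreal[OF continuous_on_id, of UNIV]])
        auto
    then show "(\<lambda>n. 1 / ennreal (\<psi> n x) * indicator {0..u} x) \<longlonglongrightarrow> 1 / ennreal (\<phi> x) * indicator {0..u} x"
      by (auto simp: indicator_def divide_ennreal_def)
  qed
  ultimately show ?thesis
    by (simp add: LIMSEQ_unique)
qed

lemma prob_passage_infinite:
  assumes \<phi>_meas [measurable]: "\<phi> \<in> borel_measurable borel" and \<phi>: "\<And>y. 0 \<le> \<phi> y"
  shows "{\<omega> \<in> space M. \<exists>t\<ge>0. \<phi> (A t \<omega>) < X t \<omega>} \<in> sets M"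
    and "prob {\<omega> \<in> space M. \<exists>t\<ge>0. \<phi> (A t \<omega>) < X t \<omega>} =
      1 - exp_minus (\<integral>\<^sup>+x\<in>{0..}. (1 / ennreal (\<phi> x)) \<partial>lborel)"
proof -
  define E where "E n = {\<omega> \<in> space M. \<exists>t\<ge>0. A t \<omega> \<le> real n \<and> \<phi> (A t \<omega>) < X t \<omega>}" for n
  have E_sets: "range E \<subseteq> sets M"
    unfolding E_def using passage_event_measurable[OF \<phi>_meas \<phi>] by blast
  have E_Un: "(\<Union>n. E n) = {\<omega> \<in> space M. \<exists>t\<ge>0. \<phi> (A t \<omega>) < X t \<omega>}"
    unfolding E_def using real_arch_simple by blast
  show "{\<omega> \<in> space M. \<exists>t\<ge>0. \<phi> (A t \<omega>) < X t \<omega>} \<in> sets M"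
    unfolding E_Un[symmetric] using E_sets by (intro sets.countable_UN) auto
  have "(\<lambda>n. prob (E n)) \<longlonglongrightarrow> prob (\<Union>n. E n)"
    by (rule finite_Lim_measure_incseq[OF E_sets]) (force simp: incseq_def E_def)
  moreover have "prob (E n) = 1 - exp_minus (\<integral>\<^sup>+x\<in>{0..real n}. (1 / ennreal (\<phi> x)) \<partial>lborel)" for n
    unfolding E_def by (rule prob_passage[OF \<phi>_meas \<phi>]) auto
  moreover have "(\<lambda>n. 1 - exp_minus (\<integral>\<^sup>+x\<in>{0..real n}. (1 / ennreal (\<phi> x)) \<partial>lborel)) \<longlonglongrightarrow>
      1 - exp_minus (\<integral>\<^sup>+x\<in>{0..}. (1 / ennreal (\<phi> x)) \<partial>lborel)"
  proof (intro tendsto_diff tendsto_const tendsto_exp_minus nn_integral_LIMSEQ)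
    show "incseq (\<lambda>n x. 1 / ennreal (\<phi> x) * indicator {0..real n} x)"
      by (auto simp: incseq_def le_fun_def indicator_def)
    fix x :: real
    have "eventually (\<lambda>n. x \<le> real n) sequentially"
      using real_arch_simple[of x] eventually_ge_at_top
      by (metis (mono_tags, lifting) eventually_sequentiallyI of_nat_mono order_trans)
    then have "eventually (\<lambda>n. 1 / ennreal (\<phi> x) * indicator {0..real n} x = 1 / ennreal (\<phi> x) * indicator {0..} x) sequentially"
      by eventually_elim (simp add: indicator_def)
    then show "(\<lambda>n. 1 / ennreal (\<phi> x) * indicator {0..real n} x) \<longlonglongrightarrow> 1 / ennreal (\<phi> x) * indicator {0..} x"
      by (rule tendsto_eventually)
  qed measurable
  ultimately show "prob {\<omega> \<in> space M. \<exists>t\<ge>0. \<phi> (A t \<omega>) < X t \<omega>} =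
      1 - exp_minus (\<integral>\<^sup>+x\<in>{0..}. (1 / ennreal (\<phi> x)) \<partial>lborel)"
    by (simp add: E_Un LIMSEQ_unique)
qed

section \<open>Translation to the inverse of \<open>A\<close> and to barriers on the
  half-line\<close>

text \<open>\<open>A\<close> first exceeds \<open>u\<close> strictly after its inverse time, where
  it still equals \<open>u\<close>, so the random interval up to and including that time is exactly
  the set where \<open>A \<le> u\<close>. The null set is chosen once for all levels.\<close>

lemma AE_le_right_inverse:
  "AE \<omega> in M. \<forall>u\<ge>0. \<forall>t\<ge>0. ennreal t \<le> right_inverse A u \<omega> \<longleftrightarrow> A t \<omega> \<le> u"
  using AE_path
proof eventually_elim
  case (elim \<omega>)
  then interpret sigma_path "\<lambda>t. X t \<omega>" "\<lambda>t. A t \<omega>" by simp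
  show ?case
  proof (intro allI impI)
    fix u t :: real assume "0 \<le> u" "0 \<le> t"
    note inv = inverse_level[OF \<open>0 \<le> u\<close>]
    let ?s = "Inf {t. 0 \<le> t \<and> u < A t \<omega>}"
    have "right_inverse A u \<omega> = ennreal ?s"
    proof (rule antisym)
      show "ennreal ?s \<le> right_inverse A u \<omega>"
        unfolding right_inverse_def
        by (rule Inf_greatest) (auto intro!: ennreal_leI simp: inv(4) less_imp_le)
      \<comment> \<open>The infimum is not attained, since \<open>A\<close> equals \<open>u\<close>
        at \<open>?s\<close>; the times \<open>?s + e\<close> do belong to the set.\<close>
      show "right_inverse A u \<omega> \<le> ennreal ?s"
      proof (rule ennreal_le_epsilon)
        fix e :: real assume "0 < e"
        then have "right_inverse A u \<omega> \<le> ennreal (?s + e)"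
          unfolding right_inverse_def using inv(1) inv(4)[of "?s + e"]
          by (intro Inf_lower CollectI exI[of _ "?s + e"]) (use \<open>0 < e\<close> in auto)
        then show "right_inverse A u \<omega> \<le> ennreal ?s + ennreal e"
          using inv(1) \<open>0 < e\<close> by (simp add: ennreal_plus)
      qed
    qed
    then show "ennreal t \<le> right_inverse A u \<omega> \<longleftrightarrow> A t \<omega> \<le> u"
      using ennreal_le_iff[OF inv(1), of t] inv(4)[OF \<open>0 \<le> t\<close>] by (metis not_less)
  qed
qed

end

theorem theorem3p2:
  fixes M :: "'a measure" and F :: "ennreal \<Rightarrow> 'a measure"
    and X N A :: "real \<Rightarrow> 'a \<Rightarrow> real" and \<phi> :: "real \<Rightarrow> real"
  assumes "usual_conditions M F"
    and "class_Sigma M F X N A"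
    and "only_negative_jumps M X"
    and "AE \<omega> in M. filterlim (\<lambda>t. A t \<omega>) at_top at_top"
    and "\<phi> \<in> borel_measurable (restrict_space borel {0..})"
    and "\<And>x. x \<ge> 0 \<Longrightarrow> \<phi> x \<ge> 0"
  shows "({\<omega> \<in> space M. \<exists>t\<ge>0. X t \<omega> > \<phi> (A t \<omega>)} \<in> sets M \<and>
          measure M {\<omega> \<in> space M. \<exists>t\<ge>0. X t \<omega> > \<phi> (A t \<omega>)} =
            1 - exp_minus (\<integral>\<^sup>+x\<in>{0..}. (1 / ennreal (\<phi> x)) \<partial>lborel)) \<and>
         (\<forall>u\<ge>0.
          {\<omega> \<in> space M. \<exists>t\<ge>0. ennreal t \<le> right_inverse A u \<omega> \<and> X t \<omega> > \<phi> (A t \<omega>)} \<in> sets M \<and>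
          measure M {\<omega> \<in> space M. \<exists>t\<ge>0. ennreal t \<le> right_inverse A u \<omega> \<and> X t \<omega> > \<phi> (A t \<omega>)} =
            1 - exp_minus (\<integral>\<^sup>+x\<in>{0..u}. (1 / ennreal (\<phi> x)) \<partial>lborel))"
proof -
  interpret sigma_process M F X N A
    using assms(1-4) by (simp add: sigma_process_def sigma_process_axioms_def)
  \<comment> \<open>\<phi> is controlled only on the half-line, and \<open>A\<close> is nonnegative
    only almost surely. Freezing the value at 0 to the left gives a nonnegative Borel function on
    the whole line that agrees with \<phi> along almost every path.\<close>
  define \<psi> where "\<psi> y = \<phi> (max 0 y)" for y
  have \<psi>_meas: "\<psi> \<in> borel_measurable borel"
    unfolding \<psi>_def
    by (rule measurable_compose[OF _ assms(5)]) (auto intro!: measurable_restrict_space2)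
  have \<psi>: "0 \<le> \<psi> y" for y using assms(6) by (simp add: \<psi>_def)
  have integral: "(\<integral>\<^sup>+x\<in>B. (1 / ennreal (\<psi> x)) \<partial>lborel) = (\<integral>\<^sup>+x\<in>B. (1 / ennreal (\<phi> x)) \<partial>lborel)"
    if "B \<subseteq> {0..}" for B
    using that by (intro nn_integral_cong) (auto simp: \<psi>_def indicator_def max_def)
  have \<psi>_A: "AE \<omega> in M. \<forall>t\<ge>0. \<psi> (A t \<omega>) = \<phi> (A t \<omega>)"
    using AE_path by eventually_elim (auto simp: \<psi>_def max_def dest: sigma_path.a_nonneg)
  show ?thesis
  proof (intro conjI[of "_ \<and> _"] allI impI)
    have "AE \<omega> in M. \<omega> \<in> {\<omega> \<in> space M. \<exists>t\<ge>0. \<psi> (A t \<omega>) < X t \<omega>} \<longleftrightarrow> (\<exists>t\<ge>0. \<phi> (A t \<omega>) < X t \<omega>)"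
      using \<psi>_A AE_space by eventually_elim auto
    from measurable_prob_AE_eq[OF prob_passage_infinite(1)[OF \<psi>_meas \<psi>] this]
    show "{\<omega> \<in> space M. \<exists>t\<ge>0. X t \<omega> > \<phi> (A t \<omega>)} \<in> sets M \<and>
          measure M {\<omega> \<in> space M. \<exists>t\<ge>0. X t \<omega> > \<phi> (A t \<omega>)} =
            1 - exp_minus (\<integral>\<^sup>+x\<in>{0..}. (1 / ennreal (\<phi> x)) \<partial>lborel)"
      using prob_passage_infinite(2)[OF \<psi>_meas \<psi>] integral[of "{0..}"] by simp
  next
    fix u :: real assume u: "0 \<le> u"
    have "AE \<omega> in M. \<omega> \<in> {\<omega> \<in> space M. \<exists>t\<ge>0. A t \<omega> \<le> u \<and> \<psi> (A t \<omega>) < X t \<omega>} \<longleftrightarrow>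
        (\<exists>t\<ge>0. ennreal t \<le> right_inverse A u \<omega> \<and> \<phi> (A t \<omega>) < X t \<omega>)"
      using \<psi>_A AE_le_right_inverse AE_space by eventually_elim (use u in auto)
    from measurable_prob_AE_eq[OF passage_event_measurable[OF \<psi>_meas \<psi>] this]
    show "{\<omega> \<in> space M. \<exists>t\<ge>0. ennreal t \<le> right_inverse A u \<omega> \<and> X t \<omega> > \<phi> (A t \<omega>)} \<in> sets M \<and>
          measure M {\<omega> \<in> space M. \<exists>t\<ge>0. ennreal t \<le> right_inverse A u \<omega> \<and> X t \<omega> > \<phi> (A t \<omega>)} =
            1 - exp_minus (\<integral>\<^sup>+x\<in>{0..u}. (1 / ennreal (\<phi> x)) \<partial>lborel)"
      using prob_passage[OF \<psi>_meas \<psi> u] integral[of "{0..u}"] by simp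
  qed
qed

end
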